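(* Let $(X_{t})_{t\ge0}$ be the Bessel process of type $B_N$ starting in $0$ with parameters $\nu\ge 0,\beta>0$. Then for all $t>0$ and $y\in\mathbb R$, $$\mathbb E\Bigl(\prod_{i=1}^N (y- X_{t,i}^2)\Bigr) = c_{(\beta\nu,\beta)}^B \int_{\mathbb R^N} \Bigl(\prod_{i=1}^N(y-x_i^2)\Bigr)\, t^{-\gamma_{(\beta\nu,\beta)}^B-N/2}\,e^{-\|x\|^2/(2t)} \prod_{i<j}|x_i^2-x_j^2|^{2\beta} \prod_{i=1}^N |x_i|^{2\beta\nu}\, dx$$ $$= (2t \beta)^{N}\cdot(-1)^N\,N!\cdot L_N^{(\nu+1/(2\beta)-1)}\bigl(y/(2t\beta)\bigr).$$ Moreover, for $k=0,1,\ldots,N$, $$\mathbb E\bigl(e^N_k( X_{t}^2)\bigr)= \binom{N+\nu+\frac{1}{2\beta}-1}{k} \cdot \frac{N!}{(N-k)!}\cdot (2t \beta)^{k}.$$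
   Context: Let $N\ge1$ and $C_N^B:=\{x\in \mathbb R^N: x_1\ge x_2\ge\ldots\ge x_N\ge0\}$. For $\nu\ge0,\beta>0$, the Bessel process $(X_t)_{t\ge0}$ of type $B_N$ with parameters $\nu,\beta$, i.e. with multiplicities $(k_1,k_2)=(\nu\beta,\beta)$, is the diffusion with values in $C_N^B$ with generator $$\frac12\Delta f+\beta\sum_{i=1}^N\sum_{j\ne i}\Bigl(\frac{1}{x_i-x_j}+\frac{1}{x_i+x_j}\Bigr)\frac{\partial f}{\partial x_i}+\nu\beta\sum_{i=1}^N\frac1{x_i}\frac{\partial f}{\partial x_i}$$ with reflecting boundaries (the domain being the restrictions to $C_N^B$ of $C^2$-functions on $\mathbb R^N$ invariant under all coordinate permutations and sign changes). It satisfies, with an $N$-dimensional Brownian motion $(B_t)_{t\ge0}$, $$dX_{t,i} = dB_{t,i}+ \beta \sum_{j\ne i} \Bigl(\frac{1}{X_{t,i}-X_{t,j}}+ \frac{1}{X_{t,i}+X_{t,j}}\Bigr)dt+ \frac{\nu\beta}{X_{t,i}}dt\quad(i=1,\ldots,N),$$ with paths reflected at the boundary of $C_N^B$. For $\nu>0$ it is the (known to exist) unique strong solution of this SDE in $C_N^B$ for any deterministic start; for $\nu=0$ the last drift term is absent and reflection means that the equation for $i=N$ has an additional term $dL_t$ with $L$ continuous, adapted, nondecreasing, $L_0=0$, increasing only when $X_{t,N}=0$. It is known that for start in $0$ and $t>0$, $X_t$ has a Lebesgue density on $C_N^B$ proportional to $e^{-\|x\|^2/(2t)}\prod_{i<j}(x_i^2-x_j^2)^{2\beta}\prod_{i}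 x_i^{2\beta\nu}$. Here $\gamma^B_{(\beta\nu,\beta)}=\beta N(N-1)+\beta\nu N$, and $c^B_{(\beta\nu,\beta)}>0$ is the normalization constant for which $c^B_{(\beta\nu,\beta)}\,t^{-\gamma^B_{(\beta\nu,\beta)}-N/2}e^{-\|x\|^2/(2t)}\prod_{i<j}|x_i^2-x_j^2|^{2\beta}\prod_i|x_i|^{2\beta\nu}$ is a probability density on $\mathbb R^N$ (it does not depend on $t$). $e_k^N$ is the $k$-th elementary symmetric polynomial in $N$ variables ($e_0^N=1$), $x^2:=(x_1^2,\ldots,x_N^2)$, $\binom{a}{k}=a(a-1)\cdots(a-k+1)/k!$ for real $a$, and for $\alpha>-1$ the Laguerre polynomials are $$L_n^{(\alpha)}(x)= \sum_{k=0}^n \binom{n+\alpha}{n-k} \frac{(-x)^k}{k!}.$$ *)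

theory Defs
  imports "HOL-Probability.Probability"
begin

text \<open>
  The coordinates of \<open>\<real>\<^sup>N\<close> are indexed by a finite linearly ordered type \<open>'n\<close> with \<open>N = CARD('n)\<close>
  elements; its order plays the role of the order of \<open>1, \<dots>, N\<close>.
\<close>

definition weyl_chamber_B :: "(real ^ 'n::{finite, linorder}) set" where
  "weyl_chamber_B = {x. (\<forall>i j. i \<le> j \<longrightarrow> x $ j \<le> x $ i) \<and> (\<forall>i. 0 \<le> x $ i)}"

definition partial_deriv :: "'n::finite \<Rightarrow> (real ^ 'n \<Rightarrow> real) \<Rightarrow> real ^ 'n \<Rightarrow> real" where
  "partial_deriv i f x = frechet_derivative f (at x) (axis i 1)"

definition twice_continuously_differentiable :: "(real ^ 'n::finite \<Rightarrow> real) \<Rightarrow> bool" where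
  "twice_continuously_differentiable f \<longleftrightarrow>
     f differentiable_on UNIV \<and>
     (\<forall>i. partial_deriv i f differentiable_on UNIV) \<and>
     (\<forall>i j. continuous_on UNIV (partial_deriv j (partial_deriv i f)))"

definition weyl_invariant_B :: "(real ^ 'n::finite \<Rightarrow> real) \<Rightarrow> bool" where
  "weyl_invariant_B f \<longleftrightarrow>
     (\<forall>\<sigma> x. bij \<sigma> \<longrightarrow> f (\<chi> i. x $ \<sigma> i) = f x) \<and>
     (\<forall>k x. f (\<chi> i. if i = k then - x $ i else x $ i) = f x)"

definition bessel_operator_B ::
  "real \<Rightarrow> real \<Rightarrow> (real ^ 'n::finite \<Rightarrow> real) \<Rightarrow> real ^ 'n \<Rightarrow> real" where
  "bessel_operator_B \<nu> \<beta> f x =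
     1 / 2 * (\<Sum>i\<in>UNIV. partial_deriv i (partial_deriv i f) x)
     + \<beta> * (\<Sum>i\<in>UNIV. \<Sum>j\<in>UNIV - {i}.
         (1 / (x $ i - x $ j) + 1 / (x $ i + x $ j)) * partial_deriv i f x)
     + \<nu> * \<beta> * (\<Sum>i\<in>UNIV. 1 / x $ i * partial_deriv i f x)"

text \<open>
  On the boundary of the chamber the formula above is singular. If \<open>f\<close> is \<open>C\<^sup>2\<close> and invariant, the
  normal derivatives of \<open>f\<close> vanish there and the formula extends continuously from the interior to
  the closed chamber; this extension is the value of the generator.
\<close>

definition bessel_generator_B ::
  "real \<Rightarrow> real \<Rightarrow> (real ^ 'n::{finite, linorder} \<Rightarrow> real) \<Rightarrow> (real, 'n) vec \<Rightarrow> real" where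
  "bessel_generator_B \<nu> \<beta> f x =
     (if x \<in> interior weyl_chamber_B then bessel_operator_B \<nu> \<beta> f x
      else Lim (at x within interior weyl_chamber_B) (bessel_operator_B \<nu> \<beta> f))"

definition martingale_wrt ::
  "'a measure \<Rightarrow> (real \<Rightarrow> 'a measure) \<Rightarrow> (real \<Rightarrow> 'a \<Rightarrow> real) \<Rightarrow> bool" where
  "martingale_wrt M F Y \<longleftrightarrow>
     (\<forall>t\<ge>0. Y t \<in> borel_measurable (F t) \<and> integrable M (Y t)) \<and>
     (\<forall>s t. 0 \<le> s \<longrightarrow> s \<le> t \<longrightarrow> (AE \<omega> in M. real_cond_exp M (F s) (Y t) \<omega> = Y s \<omega>))"

text \<open>
  The diffusion with this generator, in the sense of Stroock and Varadhan: a continuous adapted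
  process in the closed chamber such that \<open>f(X\<^sub>t) - \<integral>\<^sub>0\<^sup>t (L f)(X\<^sub>s) ds\<close> is a martingale for all
  \<open>f\<close> in the domain. The boundary reflection is encoded in the domain, since the test functions are
  invariant. Compact support is imposed so that the above is a true martingale; for arbitrary
  invariant \<open>C\<^sup>2\<close> functions it is a local martingale, by stopping. The parameter \<open>x\<^sub>0\<close> is the
  starting point, and times are the nonnegative reals (negative ones are ignored).
\<close>

definition bessel_process_B ::
  "'a measure \<Rightarrow> real \<Rightarrow> real \<Rightarrow> real ^ 'n::{finite, linorder}
    \<Rightarrow> (real \<Rightarrow> 'a \<Rightarrow> (real, 'n) vec) \<Rightarrow> bool" where
  "bessel_process_B M \<nu> \<beta> x\<^sub>0 X \<longleftrightarrow>
     prob_space M \<and>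
     (\<forall>\<omega>\<in>space M. \<forall>t\<ge>0. X t \<omega> \<in> weyl_chamber_B) \<and>
     (\<forall>\<omega>\<in>space M. continuous_on {0..} (\<lambda>t. X t \<omega>)) \<and>
     (AE \<omega> in M. X 0 \<omega> = x\<^sub>0) \<and>
     (\<exists>F. filtration (space M) F \<and> (\<forall>t. subalgebra M (F t)) \<and>
        (\<forall>t\<ge>0. X t \<in> borel_measurable (F t)) \<and>
        (\<forall>f. twice_continuously_differentiable f \<and> weyl_invariant_B f \<and>
              compact (closure {x. f x \<noteq> 0}) \<longrightarrow>
           martingale_wrt M F (\<lambda>t \<omega>. f (X t \<omega>)
             - set_lebesgue_integral lborel {0..t} (\<lambda>s. bessel_generator_B \<nu> \<beta> f (X s \<omega>)))))"

definition gamma_B :: "'n::finite itself \<Rightarrow> real \<Rightarrow> real \<Rightarrow> real" where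
  "gamma_B _ \<nu> \<beta> = \<beta> * real CARD('n) * (real CARD('n) - 1) + \<beta> * \<nu> * real CARD('n)"

definition unnormalized_density_B ::
  "real \<Rightarrow> real \<Rightarrow> real \<Rightarrow> real ^ 'n::{finite, linorder} \<Rightarrow> real" where
  "unnormalized_density_B \<nu> \<beta> t x =
     t powr (- gamma_B TYPE('n) \<nu> \<beta> - real CARD('n) / 2) * exp (- (norm x)\<^sup>2 / (2 * t))
     * (\<Prod>(i, j)\<in>{(i, j). i < j}. \<bar>(x $ i)\<^sup>2 - (x $ j)\<^sup>2\<bar> powr (2 * \<beta>))
     * (\<Prod>i\<in>UNIV. \<bar>x $ i\<bar> powr (2 * \<beta> * \<nu>))"

text \<open>
  For \<open>\<nu> = 0\<close> the last factor should be \<open>1\<close>, whereas \<open>0 powr 0 = 0\<close>; this affects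
  only the null set where some coordinate vanishes.
\<close>

definition c_B :: "'n::{finite, linorder} itself \<Rightarrow> real \<Rightarrow> real \<Rightarrow> real" where
  "c_B _ \<nu> \<beta> = (THE c. c > 0 \<and>
     (\<forall>t>0. prob_space (density lborel
        (\<lambda>x :: (real, 'n) vec. ennreal (c * unnormalized_density_B \<nu> \<beta> t x)))))"

definition elem_sym :: "nat \<Rightarrow> real ^ 'n::finite \<Rightarrow> real" where
  "elem_sym k x = (\<Sum>S | card S = k. \<Prod>i\<in>S. x $ i)"

definition laguerre :: "nat \<Rightarrow> real \<Rightarrow> real \<Rightarrow> real" where
  "laguerre n \<alpha> x = (\<Sum>k\<le>n. ((real n + \<alpha>) gchoose (n - k)) * (- x) ^ k / fact k)"

end

theory Submission
  imports Defs
begin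

text \<open>
  In the variables \<open>u\<^sub>i = x\<^sub>i\<^sup>2\<close> the operator \<open>L\<close> maps \<open>e\<^sub>k\<^sub>+\<^sub>1(u)\<close> to a constant multiple of \<open>e\<^sub>k(u)\<close>:
  \<open>e\<^sub>k\<^sub>+\<^sub>1\<close> is affine in each variable, and its singular drift terms are divided differences
  once they are paired. By induction on \<open>k\<close>, the expectation of \<open>e\<^sub>k(X\<^sub>t\<^sup>2)\<close> is an explicit multiple of
  \<open>t\<^sup>k\<close>; here \<open>e\<^sub>k\<^sub>+\<^sub>1\<close> is multiplied by the cutoff \<open>(1 - |x|\<^sup>2/R)\<^sub>+\<^sup>3\<close>, and \<open>L\<close> of the product is bounded
  by a multiple of \<open>e\<^sub>k\<close> uniformly in \<open>R\<close>, so that no moment bound is needed beyond the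
  induction hypothesis.

  The moments of the density satisfy the same recursion, by integrating the divergence of
  \<open>w \<nabla>e\<^sub>k\<^sub>+\<^sub>1\<close> for the weight \<open>w\<close>. For small \<open>\<beta>\<close> the derivatives of \<open>w\<close> are singular; replacing \<open>|s|\<^sup>2\<^sup>\<beta>\<close> by
  \<open>(s\<^sup>2 + \<epsilon>)\<^sup>\<beta>\<close> makes them bounded by polynomials times a Gaussian, and after the pairing these
  bounds are uniform in \<open>\<epsilon>\<close>.
\<close>

subsection \<open>Elementary symmetric polynomials\<close>

text \<open>Both sides of the identity are matched through their moments. For the process, the
  moment m_(k+1) has time derivative \<open>rate\<close> times m_k, and integrating s^k over time
  produces the divisor k+1. For the density at time 1 the same k+1 is the degree in Euler's
  relation, contributed by the Gaussian factor; scaling then supplies t^k.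

  The martingale problem offers only compactly supported test functions, while e_(k+1) is unbounded.
  The cutoff costs nothing in the end because e_(k+1) <= |x|^2 e_k: on its support |x|^2 < R, so
  every 1/R that arises from differentiating the cutoff is absorbed. What dominates is e_k along the
  path, whose expectation, integrated over time, is finite by induction.

  For the density, each partial derivative of the regularized weight is bounded only by a constant
  of order 1/\<epsilon>. Two estimates are therefore made: a crude one for fixed \<epsilon>, which
  justifies the integration by parts, and one for the whole divergence, where every pole has become
  a quotient s^2/(s^2 + \<epsilon>) in [0, 1].\<close>

definition esym :: "'a set \<Rightarrow> nat \<Rightarrow> ('a \<Rightarrow> real) \<Rightarrow> real" where
  "esym A k u = (\<Sum>S | S \<subseteq> A \<and> card S = k. \<Prod>i\<in>S. u i)"

lemma elem_sym_eq_esym: "elem_sym k x = esym UNIV k (\<lambda>i. x $ i)"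
  by (simp add: elem_sym_def esym_def)

lemma esym_0:
  assumes "finite A"
  shows "esym A 0 u = 1"
proof -
  have "{S. S \<subseteq> A \<and> card S = 0} = {{}}"
    using assms finite_subset by fastforce
  then show ?thesis by (simp add: esym_def)
qed

lemma esym_cong: "(\<And>i. i \<in> A \<Longrightarrow> u i = v i) \<Longrightarrow> esym A k u = esym A k v"
  unfolding esym_def by (intro sum.cong prod.cong) auto

lemma esym_nonneg: "(\<And>i. i \<in> A \<Longrightarrow> 0 \<le> u i) \<Longrightarrow> 0 \<le> esym A k u"
  unfolding esym_def by (intro sum_nonneg prod_nonneg) auto

text \<open>Splitting the (k+1)-subsets by membership of \<open>i\<close> makes \<open>esym\<close>
  affine in \<open>u i\<close> with slope \<open>esym (A - {i}) k u\<close>. The derivatives of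
  \<open>esym\<close> along coordinate lines are read off from this.\<close>

lemma esym_remove:
  assumes A: "finite A" and i: "i \<in> A"
  shows "esym A (Suc k) u = esym (A - {i}) (Suc k) u + u i * esym (A - {i}) k u"
proof -
  let ?P = "{S. S \<subseteq> A - {i} \<and> card S = Suc k}" and ?Q = "{S. S \<subseteq> A - {i} \<and> card S = k}"
  have split: "{S. S \<subseteq> A \<and> card S = Suc k} = ?P \<union> insert i ` ?Q"
  proof (intro equalityI subsetI)
    fix S assume "S \<in> {S. S \<subseteq> A \<and> card S = Suc k}"
    then have S: "S \<subseteq> A" "card S = Suc k" "finite S"
      using A finite_subset by auto
    show "S \<in> ?P \<union> insert i ` ?Q"
    proof (cases "i \<in> S")
      case True
      then have "S = insert i (S - {i})" "S - {i} \<in> ?Q" using S by auto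
      then show ?thesis by blast
    qed (use S in auto)
  next
    fix S assume "S \<in> ?P \<union> insert i ` ?Q"
    then show "S \<in> {S. S \<subseteq> A \<and> card S = Suc k}"
      using i A by (auto simp: card_insert_if finite_subset[of _ "A - {i}"])
  qed
  have inj: "inj_on (insert i) ?Q"
  proof (rule inj_onI)
    fix S T assume "S \<in> ?Q" "T \<in> ?Q" "insert i S = insert i T"
    then show "S = T" by (metis (no_types, lifting) Diff_insert_absorb mem_Collect_eq subset_Diff_insert)
  qed
  have "esym A (Suc k) u = (\<Sum>S\<in>?P. \<Prod>j\<in>S. u j) + (\<Sum>S\<in>insert i ` ?Q. \<Prod>j\<in>S. u j)"
    unfolding esym_def split using A by (intro sum.union_disjoint) auto
  also have "(\<Sum>S\<in>insert i ` ?Q. \<Prod>j\<in>S. u j) = (\<Sum>S\<in>?Q. u i * (\<Prod>j\<in>S. u j))"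
    unfolding sum.reindex[OF inj] comp_def
  proof (intro sum.cong refl)
    fix S assume S: "S \<in> ?Q"
    then have "finite S" "i \<notin> S" using A finite_subset by auto
    then show "(\<Prod>j\<in>insert i S. u j) = u i * (\<Prod>j\<in>S. u j)" by simp
  qed
  finally show ?thesis by (simp add: esym_def sum_distrib_left)
qed

text \<open>Double counting: a k-subset of \<open>A\<close> contributes once for each of the
  \<open>card A - k\<close> elements outside it. Real subtraction keeps the identity valid for
  \<open>k > card A\<close>, where \<open>esym A k u\<close> is an empty sum.\<close>

lemma sum_esym_remove:
  assumes A: "finite A"
  shows "(\<Sum>i\<in>A. esym (A - {i}) k u) = (real (card A) - real k) * esym A k u"
proof -
  let ?C = "{S. S \<subseteq> A \<and> card S = k}"
  have fin: "finite ?C" using A by auto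
  have "esym (A - {i}) k u = (\<Sum>S\<in>?C. if i \<notin> S then \<Prod>j\<in>S. u j else 0)" for i
  proof -
    have "{S. S \<subseteq> A - {i} \<and> card S = k} = ?C \<inter> {S. i \<notin> S}" by auto
    then show ?thesis using fin by (simp add: esym_def sum.inter_restrict)
  qed
  then have "(\<Sum>i\<in>A. esym (A - {i}) k u)
      = (\<Sum>S\<in>?C. \<Sum>i\<in>A. if i \<notin> S then \<Prod>j\<in>S. u j else 0)"
    by (simp add: sum.swap[of _ _ ?C])
  also have "\<dots> = (\<Sum>S\<in>?C. (real (card A) - real k) * (\<Prod>j\<in>S. u j))"
  proof (intro sum.cong refl)
    fix S assume S: "S \<in> ?C"
    have "(\<Sum>i\<in>A. if i \<notin> S then \<Prod>j\<in>S. u j else 0) = (\<Sum>i\<in>A \<inter> {i. i \<notin> S}. \<Prod>j\<in>S. u j)"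
      by (subst sum.inter_restrict[OF A]) simp
    also have "A \<inter> {i. i \<notin> S} = A - S" by auto
    also have "real (card (A - S)) = real (card A) - real k"
    proof -
      have "finite S" using S A finite_subset by auto
      then show ?thesis using S A by (auto simp: card_Diff_subset card_mono of_nat_diff)
    qed
    then have "(\<Sum>i\<in>A - S. \<Prod>j\<in>S. u j) = (real (card A) - real k) * (\<Prod>j\<in>S. u j)" by simp
    finally show "(\<Sum>i\<in>A. if i \<notin> S then \<Prod>j\<in>S. u j else 0) = (real (card A) - real k) * (\<Prod>j\<in>S. u j)" .
  qed
  finally show ?thesis by (simp add: esym_def sum_distrib_left)
qed

lemma sum_esym_remove2:
  assumes A: "finite A"
  shows "(\<Sum>i\<in>A. \<Sum>j\<in>A - {i}. esym (A - {i, j}) k u)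
    = (real (card A) - real k) * (real (card A) - real k - 1) * esym A k u"
proof -
  have "(\<Sum>i\<in>A. \<Sum>j\<in>A - {i}. esym (A - {i, j}) k u)
      = (\<Sum>i\<in>A. (real (card A) - real k - 1) * esym (A - {i}) k u)"
  proof (intro sum.cong refl)
    fix i assume i: "i \<in> A"
    have 1: "real (card (A - {i})) = real (card A) - 1"
      using i A by (metis One_nat_def card_Suc_Diff1 diff_add_cancel of_nat_Suc of_nat_1 add_diff_cancel_left')
    have "(\<Sum>j\<in>A - {i}. esym (A - {i, j}) k u) = (\<Sum>j\<in>A - {i}. esym (A - {i} - {j}) k u)"
      by (simp add: Diff_insert2[symmetric])
    also have "\<dots> = (real (card (A - {i})) - real k) * esym (A - {i}) k u"
      using A by (intro sum_esym_remove) auto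
    finally show "(\<Sum>j\<in>A - {i}. esym (A - {i, j}) k u) = (real (card A) - real k - 1) * esym (A - {i}) k u"
      by (simp add: 1 algebra_simps)
  qed
  then show ?thesis by (simp add: sum_distrib_left[symmetric] sum_esym_remove[OF A])
qed

text \<open>Euler's relation for a homogeneous polynomial of degree k+1, with
  \<open>esym (A - {i}) k u\<close> as its partial derivative in \<open>u i\<close>. With N =
  \<open>card A\<close>, \<open>esym_remove\<close> turns the sum into N - (N - k - 1) copies of
  \<open>esym A (Suc k) u\<close>.\<close>

lemma esym_Euler:
  assumes A: "finite A"
  shows "(\<Sum>i\<in>A. u i * esym (A - {i}) k u) = real (Suc k) * esym A (Suc k) u"
proof -
  have "(\<Sum>i\<in>A. u i * esym (A - {i}) k u) = (\<Sum>i\<in>A. esym A (Suc k) u - esym (A - {i}) (Suc k) u)"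
    using esym_remove[OF A, of _ k u] by (intro sum.cong) auto
  then show ?thesis
    by (simp add: sum_subtractf sum_esym_remove[OF A] algebra_simps)
qed

lemma esym_mono_set:
  assumes "finite A" "\<And>i. i \<in> A \<Longrightarrow> 0 \<le> u i" "B \<subseteq> A"
  shows "esym B k u \<le> esym A k u"
  unfolding esym_def using assms by (intro sum_mono2) (auto intro!: prod_nonneg)

text \<open>Euler's relation with each partial derivative bounded by \<open>esym A k u\<close>. For
  squared coordinates the first factor is the squared norm, so a bound on the norm lets e_k control
  e_(k+1).\<close>

lemma esym_Suc_le:
  assumes A: "finite A" and u: "\<And>i. i \<in> A \<Longrightarrow> 0 \<le> u i"
  shows "esym A (Suc k) u \<le> (\<Sum>i\<in>A. u i) * esym A k u"
proof -
  have "esym A (Suc k) u \<le> real (Suc k) * esym A (Suc k) u"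
    using esym_nonneg[of A u "Suc k"] u by (simp add: algebra_simps)
  also have "\<dots> = (\<Sum>i\<in>A. u i * esym (A - {i}) k u)"
    using esym_Euler[OF A] by simp
  also have "\<dots> \<le> (\<Sum>i\<in>A. u i * esym A k u)"
    using A u by (intro sum_mono mult_left_mono esym_mono_set) auto
  finally show ?thesis by (simp add: sum_distrib_right)
qed

text \<open>Let p and q be e_k and e_(k-1) of the variables other than i and j (q = 0 for k = 0).
  Then e_k without i is p + u_j q, and without j it is p + u_i q, so the terms u_i u_j q cancel. The
  factor \<open>u i - u j\<close> later cancels the poles of the drift and of the logarithmic
  derivative of the weight.\<close>

lemma esym_divided_difference:
  assumes A: "finite A" and ij: "i \<in> A" "j \<in> A" "i \<noteq> j"
  shows "u i * esym (A - {i}) k u - u j * esym (A - {j}) k u = (u i - u j) * esym (A - {i, j}) k u"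
proof (cases k)
  case 0
  then show ?thesis using A by (simp add: esym_0)
next
  case (Suc l)
  have "A - {i} - {j} = A - {i, j}" "A - {j} - {i} = A - {i, j}" by auto
  then show ?thesis
    using esym_remove[of "A - {i}" j l u] esym_remove[of "A - {j}" i l u] A ij
    by (simp add: Suc algebra_simps)
qed

text \<open>Vieta: expand over the set \<open>B\<close> of factors that contribute
  \<open>- u i\<close>, then group these sets by cardinality.\<close>

lemma prod_diff_esym:
  assumes A: "finite A"
  shows "(\<Prod>i\<in>A. y - u i) = (\<Sum>k\<le>card A. (-1) ^ k * esym A k u * y ^ (card A - k))"
proof -
  have "(\<Prod>i\<in>A. y - u i) = (\<Prod>i\<in>A. - u i + y)" by (simp add: algebra_simps)
  also have "\<dots> = (\<Sum>B\<in>Pow A. (\<Prod>i\<in>B. - u i) * (\<Prod>i\<in>A - B. y))"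
    by (rule prod_add[OF A])
  also have "\<dots> = (\<Sum>B\<in>Pow A. (-1) ^ card B * (\<Prod>i\<in>B. u i) * y ^ (card A - card B))"
    using A by (intro sum.cong refl) (auto simp: prod_uminus card_Diff_subset finite_subset)
  also have "\<dots> = (\<Sum>k\<le>card A. \<Sum>B\<in>{B \<in> Pow A. card B = k}.
      (-1) ^ card B * (\<Prod>i\<in>B. u i) * y ^ (card A - card B))"
    using A by (intro sum.group[symmetric]) (auto simp: card_mono)
  also have "\<dots> = (\<Sum>k\<le>card A. (-1) ^ k * esym A k u * y ^ (card A - k))"
    unfolding esym_def sum_distrib_left sum_distrib_right by (intro sum.cong) auto
  finally show ?thesis .
qed

subsection \<open>Continuously differentiable test functions\<close>

text \<open>A class closed under sums, products and composition. A function is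
  \<open>twice_continuously_differentiable\<close> as soon as it and its partial derivatives belong
  to it, so no mixed second derivative has to be written down.\<close>

definition continuously_differentiable :: "(real ^ 'n::finite \<Rightarrow> real) \<Rightarrow> bool" where
  "continuously_differentiable f \<longleftrightarrow>
     f differentiable_on UNIV \<and> (\<forall>i. continuous_on UNIV (partial_deriv i f))"

text \<open>Separates existence from value: differentiability comes from closure properties, and the
  value from one-variable calculus along a coordinate line.\<close>

lemma partial_deriv_eqI:
  fixes f :: "real ^ 'n::finite \<Rightarrow> real"
  assumes "f differentiable (at x)"
    and "((\<lambda>s. f (x + s *\<^sub>R axis i 1)) has_real_derivative d) (at 0)"
  shows "partial_deriv i f x = d"
proof -
  have f: "(f has_derivative frechet_derivative f (at x)) (at x)"
    using assms(1) frechet_derivative_works by blast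
  have "((\<lambda>s::real. x + s *\<^sub>R axis i 1) has_derivative (\<lambda>s. s *\<^sub>R axis i 1)) (at 0)"
    by (auto intro!: derivative_eq_intros)
  from diff_chain_at[OF this] f
  have "((\<lambda>s. f (x + s *\<^sub>R axis i 1)) has_derivative (\<lambda>s. frechet_derivative f (at x) (s *\<^sub>R axis i 1))) (at 0)"
    by (simp add: comp_def)
  moreover have "((\<lambda>s. f (x + s *\<^sub>R axis i 1)) has_derivative (*) d) (at 0)"
    using assms(2) by (simp add: has_field_derivative_def)
  ultimately have "(\<lambda>s. frechet_derivative f (at x) (s *\<^sub>R axis i 1)) = (*) d"
    by (rule has_derivative_unique)
  from fun_cong[OF this, of 1] show ?thesis by (simp add: partial_deriv_def)
qed

lemma partial_deriv_has_derivative: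
  "(f has_derivative f') (at x) \<Longrightarrow> partial_deriv i f x = f' (axis i 1)"
  unfolding partial_deriv_def using frechet_derivative_at by metis

lemma has_derivative_frechet:
  "continuously_differentiable f \<Longrightarrow> (f has_derivative frechet_derivative f (at x)) (at x)"
  by (auto simp: continuously_differentiable_def differentiable_on_def frechet_derivative_works[symmetric])

lemma continuously_differentiable_imp_continuous:
  "continuously_differentiable f \<Longrightarrow> continuous_on S f"
  by (meson continuous_on_subset continuously_differentiable_def differentiable_imp_continuous_on subset_UNIV)

lemma continuously_differentiableI:
  assumes "\<And>x. (f has_derivative f' x) (at x)" "\<And>i. continuous_on UNIV (\<lambda>x. f' x (axis i 1))"
  shows "continuously_differentiable f"
proof -
  have "partial_deriv i f = (\<lambda>x. f' x (axis i 1))" for i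
    using assms(1) by (auto intro!: ext partial_deriv_has_derivative)
  with assms show ?thesis
    unfolding continuously_differentiable_def differentiable_on_def differentiable_def by auto
qed

lemma continuous_on_frechet:
  "continuously_differentiable f \<Longrightarrow> continuous_on UNIV (\<lambda>x. frechet_derivative f (at x) (axis i 1))"
  by (simp add: continuously_differentiable_def partial_deriv_def[abs_def])

lemma continuously_differentiable_const: "continuously_differentiable (\<lambda>_. c)"
  by (rule continuously_differentiableI[where f' = "\<lambda>_ _. 0"]) auto

lemma continuously_differentiable_nth: "continuously_differentiable (\<lambda>x. x $ i)"
  by (rule continuously_differentiableI[where f' = "\<lambda>_ h. h $ i"])
    (auto intro: bounded_linear.has_derivative bounded_linear_vec_nth)

lemma continuously_differentiable_add:
  assumes "continuously_differentiable f" "continuously_differentiable g"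
  shows "continuously_differentiable (\<lambda>x. f x + g x)"
  by (rule continuously_differentiableI[OF has_derivative_add[OF assms[THEN has_derivative_frechet]]])
    (intro continuous_intros assms continuous_on_frechet)

lemma continuously_differentiable_mult:
  assumes "continuously_differentiable f" "continuously_differentiable g"
  shows "continuously_differentiable (\<lambda>x. f x * g x)"
  by (rule continuously_differentiableI[OF has_derivative_mult[OF assms[THEN has_derivative_frechet]]])
    (intro continuous_intros assms continuous_on_frechet continuously_differentiable_imp_continuous)

lemma continuously_differentiable_compose:
  assumes f: "continuously_differentiable f"
    and h: "\<And>s. (h has_real_derivative h' s) (at s)" and h': "continuous_on UNIV h'"
  shows "continuously_differentiable (\<lambda>x. h (f x))"
proof (rule continuously_differentiableI)
  fix x
  have "(h has_derivative (*) (h' (f x))) (at (f x))"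
    using h[of "f x"] by (simp add: has_field_derivative_def)
  from diff_chain_at[OF has_derivative_frechet[OF f] this]
  show "((\<lambda>x. h (f x)) has_derivative (\<lambda>v. h' (f x) * frechet_derivative f (at x) v)) (at x)"
    by (simp add: comp_def)
next
  fix i
  show "continuous_on UNIV (\<lambda>x. h' (f x) * frechet_derivative f (at x) (axis i 1))"
    using continuously_differentiable_imp_continuous[OF f]
    by (intro continuous_intros f continuous_on_frechet continuous_on_compose2[OF h']) auto
qed

lemma continuously_differentiable_sum:
  "(\<And>i. i \<in> I \<Longrightarrow> continuously_differentiable (f i)) \<Longrightarrow> continuously_differentiable (\<lambda>x. \<Sum>i\<in>I. f i x)"
  by (induction I rule: infinite_finite_induct)
    (auto intro: continuously_differentiable_const continuously_differentiable_add)

lemma continuously_differentiable_prod: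
  "(\<And>i. i \<in> I \<Longrightarrow> continuously_differentiable (f i)) \<Longrightarrow> continuously_differentiable (\<lambda>x. \<Prod>i\<in>I. f i x)"
  by (induction I rule: infinite_finite_induct)
    (auto intro: continuously_differentiable_const continuously_differentiable_mult)

lemma norm_sq_eq_sum: "(norm (x :: real ^ 'n::finite))\<^sup>2 = (\<Sum>i\<in>UNIV. (x $ i)\<^sup>2)"
  by (simp add: norm_vec_def L2_set_def sum_nonneg)

lemma continuously_differentiable_sq: "continuously_differentiable (\<lambda>x. (x $ i)\<^sup>2)"
  unfolding power2_eq_square
  by (intro continuously_differentiable_mult continuously_differentiable_nth)

lemma continuously_differentiable_norm_sq:
  "continuously_differentiable (\<lambda>x :: real ^ 'n::finite. (norm x)\<^sup>2)"
  unfolding norm_sq_eq_sum by (intro continuously_differentiable_sum continuously_differentiable_sq)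

abbreviation (input) sq :: "real ^ 'n \<Rightarrow> 'n \<Rightarrow> real" where
  "sq x \<equiv> \<lambda>i. (x $ i)\<^sup>2"

lemma continuously_differentiable_esym:
  "continuously_differentiable (\<lambda>x :: real ^ 'n::finite. esym A k (sq x))"
  unfolding esym_def
  by (intro continuously_differentiable_sum continuously_differentiable_prod continuously_differentiable_sq)

lemmas continuously_differentiable_intros =
  continuously_differentiable_const continuously_differentiable_nth continuously_differentiable_add
  continuously_differentiable_mult continuously_differentiable_norm_sq continuously_differentiable_esym

section \<open>Cutoffs and compactly supported test functions\<close>

definition cutoff :: "nat \<Rightarrow> real \<Rightarrow> real \<Rightarrow> real" where
  "cutoff n R s = max 0 (1 - s / R) ^ n"

lemma DERIV_max_power:
  "((\<lambda>s::real. max 0 s ^ Suc (Suc n)) has_real_derivative real (Suc (Suc n)) * max 0 s ^ Suc n) (at s)"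
proof -
  consider "s < 0" | "s > 0" | "s = 0" by linarith
  then show ?thesis
  proof cases
    case 1
    have "((\<lambda>s::real. 0) has_real_derivative real (Suc (Suc n)) * max 0 s ^ Suc n) (at s)"
      using 1 by simp
    then show ?thesis
      by (rule has_field_derivative_transform_within_open[where S = "{..<0}"]) (use 1 in auto)
  next
    case 2
    have "((\<lambda>s::real. s ^ Suc (Suc n)) has_real_derivative real (Suc (Suc n)) * max 0 s ^ Suc n) (at s)"
      using 2 by (auto intro!: derivative_eq_intros simp del: power_Suc)
    then show ?thesis
      by (rule has_field_derivative_transform_within_open[where S = "{0<..}"]) (use 2 in auto)
  next
    case 3
    have "((\<lambda>h::real. max 0 h ^ Suc n) \<longlongrightarrow> max 0 0 ^ Suc n) (at 0)"
      by (intro tendsto_intros)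
    then have "((\<lambda>h::real. max 0 h ^ Suc n) \<longlongrightarrow> 0) (at 0)" by simp
    \<comment> \<open>At the kink the quotient is again a power of \<open>max 0 h\<close>: it is
      h^(n+1) for h > 0, and both sides vanish for h < 0. The exponent is positive, hence the limit
      0.\<close>
    moreover have "\<forall>\<^sub>F h in at (0::real). max 0 h ^ Suc n = (max 0 (0 + h) ^ Suc (Suc n) - max 0 0 ^ Suc (Suc n)) / h"
      by (intro eventually_at_filter[THEN iffD2] always_eventually) (auto simp: max_def)
    ultimately have "((\<lambda>h::real. (max 0 (0 + h) ^ Suc (Suc n) - max 0 0 ^ Suc (Suc n)) / h) \<longlongrightarrow> 0) (at 0)"
      using tendsto_cong by force
    then show ?thesis using 3 by (simp add: DERIV_def)
  qed
qed

lemma DERIV_cutoff: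
  assumes "R > 0"
  shows "(cutoff (Suc (Suc n)) R has_real_derivative - real (Suc (Suc n)) / R * cutoff (Suc n) R s) (at s)"
proof -
  have "((\<lambda>s. 1 - s / R) has_real_derivative - 1 / R) (at s)"
    using assms by (auto intro!: derivative_eq_intros)
  from DERIV_chain2[OF DERIV_max_power[of n "1 - s / R"] this] show ?thesis
    by (simp add: cutoff_def[abs_def] mult.commute del: power_Suc of_nat_Suc)
qed

lemma continuous_on_cutoff [continuous_intros]:
  "R > 0 \<Longrightarrow> continuous_on S f \<Longrightarrow> continuous_on S (\<lambda>x. cutoff n R (f x))"
  unfolding cutoff_def by (intro continuous_intros) auto

lemma cutoff_nonneg: "0 \<le> cutoff n R s" and cutoff_le_1: "0 \<le> s \<Longrightarrow> 0 < R \<Longrightarrow> cutoff n R s \<le> 1"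
  by (auto simp: cutoff_def intro: power_le_one)

lemma cutoff_eq_0: "R \<le> s \<Longrightarrow> 0 < R \<Longrightarrow> n > 0 \<Longrightarrow> cutoff n R s = 0"
  by (auto simp: cutoff_def field_simps)

lemma continuously_differentiable_cutoff:
  assumes "R > 0" "continuously_differentiable f"
  shows "continuously_differentiable (\<lambda>x. cutoff (Suc (Suc n)) R (f x))"
  using assms
  by (intro continuously_differentiable_compose[OF assms(2) DERIV_cutoff]) (auto intro!: continuous_intros)

text \<open>The cutoff is a cube because this is the smallest power that is twice continuously differentiable.\<close>

definition test_fun :: "nat \<Rightarrow> real \<Rightarrow> real ^ 'n::finite \<Rightarrow> real" where
  "test_fun k R x = esym UNIV (Suc k) (sq x) * cutoff 3 R ((norm x)\<^sup>2)"

text \<open>The derivative of \<open>test_fun\<close> in the variable u_i = x_i^2. The derivative in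
  x_i is 2 x_i times this, and that explicit factor x_i is what cancels the pole 1/x_i of the wall
  drift.\<close>

definition test_grad :: "nat \<Rightarrow> real \<Rightarrow> 'n \<Rightarrow> real ^ 'n::finite \<Rightarrow> real" where
  "test_grad k R i x = esym (UNIV - {i}) k (sq x) * cutoff 3 R ((norm x)\<^sup>2)
     + esym UNIV (Suc k) (sq x) * (- 3 / R * cutoff 2 R ((norm x)\<^sup>2))"

lemma continuously_differentiable_test_fun:
  assumes "R > 0"
  shows "continuously_differentiable (test_fun k R)" "continuously_differentiable (test_grad k R i)"
  unfolding test_fun_def[abs_def] test_grad_def[abs_def]
  by (intro continuously_differentiable_intros assms
    continuously_differentiable_cutoff[where n = 0, folded numeral_2_eq_2]
    continuously_differentiable_cutoff[where n = "Suc 0", folded numeral_2_eq_2 numeral_3_eq_3])+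

lemma continuously_differentiable_imp_differentiable:
  "continuously_differentiable f \<Longrightarrow> f differentiable (at x)"
  by (simp add: continuously_differentiable_def differentiable_on_def)

lemma DERIV_norm_sq_line:
  fixes x :: "real ^ 'n::finite"
  shows "((\<lambda>s. (norm (x + s *\<^sub>R axis i 1))\<^sup>2) has_real_derivative 2 * x $ i) (at 0)"
proof -
  have "(\<lambda>s. (norm (x + s *\<^sub>R axis i 1))\<^sup>2)
      = (\<lambda>s. (norm x)\<^sup>2 + 2 * s * x $ i + s\<^sup>2)"
    by (rule ext, unfold power2_norm_eq_inner)
      (simp add: inner_add_left inner_add_right inner_axis inner_axis' algebra_simps inner_commute power2_eq_square[of "_ :: real"])
  then show ?thesis by (auto intro!: derivative_eq_intros)
qed

lemma DERIV_esym_line: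
  fixes x :: "real ^ 'n::finite"
  shows "((\<lambda>s. esym UNIV (Suc k) (sq (x + s *\<^sub>R axis i 1))) has_real_derivative
    2 * x $ i * esym (UNIV - {i}) k (sq x)) (at 0)"
    and "esym (UNIV - {i}) k (sq (x + s *\<^sub>R axis i 1)) = esym (UNIV - {i}) k (sq x)"
proof -
  have *: "esym (UNIV - {i}) k (sq (x + s *\<^sub>R axis i 1)) = esym (UNIV - {i}) k (sq x)" for s k
    by (intro esym_cong) (simp add: axis_def)
  then show "esym (UNIV - {i}) k (sq (x + s *\<^sub>R axis i 1)) = esym (UNIV - {i}) k (sq x)" .
  have "(\<lambda>s. esym UNIV (Suc k) (sq (x + s *\<^sub>R axis i 1)))
     = (\<lambda>s. esym (UNIV - {i}) (Suc k) (sq x) + (x $ i + s)\<^sup>2 * esym (UNIV - {i}) k (sq x))"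
    using esym_remove[of UNIV i k] * by (simp add: axis_def)
  then show "((\<lambda>s. esym UNIV (Suc k) (sq (x + s *\<^sub>R axis i 1))) has_real_derivative
    2 * x $ i * esym (UNIV - {i}) k (sq x)) (at 0)"
    by (auto intro!: derivative_eq_intros)
qed

lemma DERIV_cutoff_line:
  fixes x :: "real ^ 'n::finite"
  assumes "R > 0"
  shows "((\<lambda>s. cutoff (Suc (Suc n)) R ((norm (x + s *\<^sub>R axis i 1))\<^sup>2)) has_real_derivative
    - real (Suc (Suc n)) / R * cutoff (Suc n) R ((norm x)\<^sup>2) * (2 * x $ i)) (at 0)"
  using DERIV_chain2[OF DERIV_cutoff[OF assms] DERIV_norm_sq_line[of x i], of n] by simp

lemma partial_deriv_test_fun:
  fixes i :: "'n::finite"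
  assumes R: "R > 0"
  shows "partial_deriv i (test_fun k R) = (\<lambda>x. 2 * x $ i * test_grad k R i x)"
proof (rule ext, rule partial_deriv_eqI)
  fix x :: "real ^ 'n"
  show "test_fun k R differentiable at x"
    by (intro continuously_differentiable_imp_differentiable continuously_differentiable_test_fun R)
  show "((\<lambda>s. test_fun k R (x + s *\<^sub>R axis i 1)) has_real_derivative 2 * x $ i * test_grad k R i x) (at 0)"
    unfolding test_fun_def
    by (rule DERIV_cong[OF DERIV_mult[OF DERIV_esym_line(1) DERIV_cutoff_line[OF R, of "Suc 0", folded numeral_2_eq_2 numeral_3_eq_3]]])
      (simp add: test_grad_def algebra_simps)
qed

text \<open>For a function g of u_i = x_i^2 the second derivative in x_i is 2 g' + 4 u_i g''. Since
  \<open>esym\<close> is affine in u_i, g'' consists of the cross term, counted twice, and the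
  second derivative of the cutoff.\<close>

lemma partial_deriv2_test_fun:
  fixes x :: "real ^ 'n::finite"
  assumes R: "R > 0"
  shows "partial_deriv i (partial_deriv i (test_fun k R)) x
    = 2 * test_grad k R i x + 4 * (x $ i)\<^sup>2 *
       (2 * esym (UNIV - {i}) k (sq x) * (- 3 / R * cutoff 2 R ((norm x)\<^sup>2))
        + esym UNIV (Suc k) (sq x) * (6 / R\<^sup>2 * cutoff 1 R ((norm x)\<^sup>2)))"
  unfolding partial_deriv_test_fun[OF R]
proof (rule partial_deriv_eqI)
  show "(\<lambda>x. 2 * x $ i * test_grad k R i x) differentiable at x"
    by (intro continuously_differentiable_imp_differentiable continuously_differentiable_intros
      continuously_differentiable_test_fun R)
  have g: "((\<lambda>s. test_grad k R i (x + s *\<^sub>R axis i 1)) has_real_derivative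
      2 * x $ i * (2 * esym (UNIV - {i}) k (sq x) * (- 3 / R * cutoff 2 R ((norm x)\<^sup>2))
        + esym UNIV (Suc k) (sq x) * (6 / R\<^sup>2 * cutoff 1 R ((norm x)\<^sup>2)))) (at 0)"
    unfolding test_grad_def DERIV_esym_line(2)
    by (rule DERIV_cong[OF DERIV_add[OF DERIV_cmult[OF DERIV_cutoff_line[OF R, of "Suc 0", folded numeral_2_eq_2 numeral_3_eq_3]]
       DERIV_mult[OF DERIV_esym_line(1) DERIV_cmult[OF DERIV_cutoff_line[OF R, of 0, folded numeral_2_eq_2]]]]])
      (simp add: algebra_simps power2_eq_square)
  have l: "((\<lambda>s. 2 * (x + s *\<^sub>R axis i 1) $ i) has_real_derivative 2) (at 0)"
    by (auto intro!: derivative_eq_intros simp: axis_def)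
  show "((\<lambda>s. 2 * (x + s *\<^sub>R axis i 1) $ i * test_grad k R i (x + s *\<^sub>R axis i 1)) has_real_derivative
    2 * test_grad k R i x + 4 * (x $ i)\<^sup>2 *
       (2 * esym (UNIV - {i}) k (sq x) * (- 3 / R * cutoff 2 R ((norm x)\<^sup>2))
        + esym UNIV (Suc k) (sq x) * (6 / R\<^sup>2 * cutoff 1 R ((norm x)\<^sup>2)))) (at 0)"
    by (rule DERIV_cong[OF DERIV_mult[OF l g]]) (simp add: algebra_simps power2_eq_square)
qed

lemma twice_continuously_differentiable_test_fun:
  assumes "R > 0"
  shows "twice_continuously_differentiable (test_fun k R)"
proof -
  have "continuously_differentiable (\<lambda>x. 2 * x $ i * test_grad k R i x)" for i
    by (intro continuously_differentiable_intros continuously_differentiable_test_fun assms)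
  then show ?thesis
    using continuously_differentiable_test_fun(1)[OF assms]
    unfolding twice_continuously_differentiable_def partial_deriv_test_fun[OF assms]
    by (auto simp: continuously_differentiable_def)
qed

lemma weyl_invariant_test_fun: "weyl_invariant_B (test_fun k R :: real ^ 'n::finite \<Rightarrow> real)"
  unfolding weyl_invariant_B_def
proof (intro conjI allI impI)
  fix \<sigma> :: "'n \<Rightarrow> 'n" and x :: "real ^ 'n" assume \<sigma>: "bij \<sigma>"
  have "(\<Sum>i\<in>UNIV. (x $ \<sigma> i)\<^sup>2) = (\<Sum>i\<in>UNIV. (x $ i)\<^sup>2)"
    using sum.reindex_bij_betw[OF \<sigma>, of "\<lambda>i. (x $ i)\<^sup>2"] by simp
  moreover have "esym UNIV (Suc k) (\<lambda>i. (x $ \<sigma> i)\<^sup>2) = esym UNIV (Suc k) (sq x)"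
  proof -
    have "bij_betw (image \<sigma>) {S. card S = Suc k} {S. card S = Suc k}"
    proof (rule bij_betw_byWitness[where f' = "image (inv \<sigma>)"])
      have inv: "inj \<sigma>" "inj (inv \<sigma>)" "inv \<sigma> \<circ> \<sigma> = id" "\<sigma> \<circ> inv \<sigma> = id"
        using \<sigma> by (auto simp: bij_is_inj bij_is_surj surj_iff[symmetric] bij_imp_bij_inv inj_iff[symmetric])
      show "\<forall>S\<in>{S. card S = Suc k}. inv \<sigma> ` \<sigma> ` S = S" "\<forall>S\<in>{S. card S = Suc k}. \<sigma> ` inv \<sigma> ` S = S"
        by (auto simp: image_comp inv)
      show "(`) \<sigma> ` {S. card S = Suc k} \<subseteq> {S. card S = Suc k}" "(`) (inv \<sigma>) ` {S. card S = Suc k} \<subseteq> {S. card S = Suc k}"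
        using inv by (auto simp: card_image inj_on_subset)
    qed
    from sum.reindex_bij_betw[OF this, of "\<lambda>S. \<Prod>i\<in>S. (x $ i)\<^sup>2"]
    have "esym UNIV (Suc k) (sq x) = (\<Sum>S | card S = Suc k. \<Prod>i\<in>\<sigma> ` S. (x $ i)\<^sup>2)"
      by (simp add: esym_def)
    also have "\<dots> = esym UNIV (Suc k) (\<lambda>i. (x $ \<sigma> i)\<^sup>2)"
      using bij_is_inj[OF \<sigma>] by (simp add: esym_def prod.reindex inj_on_subset)
    finally show ?thesis by simp
  qed
  ultimately show "test_fun k R (\<chi> i. x $ \<sigma> i) = test_fun k R x"
    by (simp add: test_fun_def norm_sq_eq_sum)
next
  fix j and x :: "real ^ 'n"
  have "(if i = j then - x $ i else x $ i)\<^sup>2 = (x $ i)\<^sup>2" for i by simp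
  then show "test_fun k R (\<chi> i. if i = j then - x $ i else x $ i) = test_fun k R x"
    by (simp only: test_fun_def norm_sq_eq_sum vec_lambda_beta)
qed

lemma compact_support_test_fun:
  assumes "R > 0"
  shows "compact (closure {x. test_fun k R x \<noteq> 0})"
proof -
  have "{x. test_fun k R x \<noteq> 0} \<subseteq> cball 0 (sqrt R)"
  proof
    fix x :: "real ^ 'n" assume "x \<in> {x. test_fun k R x \<noteq> 0}"
    then have "(norm x)\<^sup>2 < R"
      using cutoff_eq_0[of R "(norm x)\<^sup>2" 3] assms by (force simp: test_fun_def)
    then show "x \<in> cball 0 (sqrt R)"
      by (simp add: real_le_rsqrt)
  qed
  then have "bounded {x. test_fun k R x \<noteq> 0}" using bounded_cball bounded_subset by blast
  then show ?thesis by (simp add: compact_closure)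
qed

subsection \<open>The generator on the test functions\<close>

lemma sum_offdiag_swap:
  assumes "finite A"
  shows "(\<Sum>i\<in>A. \<Sum>j\<in>A - {i}. f i j) = (\<Sum>i\<in>A. \<Sum>j\<in>A - {i}. f j i)"
proof -
  have *: "(\<Sum>j\<in>A - {i}. g j) = (\<Sum>j\<in>A. if j \<noteq> i then g j else 0)" for i and g :: "'a \<Rightarrow> 'b"
    using assms by (intro sum.mono_neutral_cong_left) auto
  show ?thesis
    unfolding * by (subst sum.swap) (intro sum.cong refl, auto)
qed

text \<open>Pairs the repulsion term of (i, j) with that of (j, i). Each may have a pole at x_i =
  x_j; for the test functions the sum has none.\<close>

lemma sum_offdiag_symmetrize:
  fixes f :: "'a \<Rightarrow> 'a \<Rightarrow> real"
  assumes "finite A"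
  shows "(\<Sum>i\<in>A. \<Sum>j\<in>A - {i}. f i j) = 1 / 2 * (\<Sum>i\<in>A. \<Sum>j\<in>A - {i}. f i j + f j i)"
  using sum_offdiag_swap[OF assms, of f] by (simp add: sum.distrib)

text \<open>The factor in L e_(k+1) = \<open>rate\<close> e_k for squared variables: half the
  Laplacian contributes N - k, the wall drift 2 \<nu> \<beta> (N - k), and the repulsion 2 \<beta>
  (N - k) (N - k - 1). It vanishes at k = N, in accordance with e_(N+1) = 0.\<close>

definition rate :: "'n::finite itself \<Rightarrow> real \<Rightarrow> real \<Rightarrow> nat \<Rightarrow> real" where
  "rate _ \<nu> \<beta> k = (real CARD('n) - real k) * (1 + 2 * \<nu> * \<beta> + 2 * \<beta> * (real CARD('n) - real k - 1))"

text \<open>The generator on \<open>test_fun\<close> after all poles have cancelled: polynomials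
  times powers of the cutoff, hence continuous across the walls. The first summand gives the limit
  for large R; the others carry 1/R or 1/R^2.\<close>

definition test_gen :: "real \<Rightarrow> real \<Rightarrow> nat \<Rightarrow> real \<Rightarrow> real ^ 'n::finite \<Rightarrow> real" where
  "test_gen \<nu> \<beta> k R x =
     rate TYPE('n) \<nu> \<beta> k * esym UNIV k (sq x) * cutoff 3 R ((norm x)\<^sup>2)
     + esym UNIV (Suc k) (sq x) *
       (((1 + 2 * \<nu> * \<beta>) * real CARD('n) + 4 * real (Suc k) + 2 * \<beta> * real CARD('n) * (real CARD('n) - 1))
          * (- 3 / R * cutoff 2 R ((norm x)\<^sup>2))
        + 2 * (norm x)\<^sup>2 * (6 / R\<^sup>2 * cutoff 1 R ((norm x)\<^sup>2)))"

text \<open>With u = x^2, 1/(x_i - x_j) + 1/(x_i + x_j) = 2 x_i / (u_i - u_j). Together with the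
  factor 2 x_i of the gradient, each repulsion term becomes 4 u_i q_i / (u_i - u_j), and the wall
  drift loses its 1/x_i.\<close>

lemma bessel_operator_test_fun:
  fixes x :: "real ^ 'n::{finite, linorder}"
  assumes R: "R > 0" and ne: "\<And>i j. i \<noteq> j \<Longrightarrow> x $ i \<noteq> x $ j" and pos: "\<And>i. 0 < x $ i"
  shows "bessel_operator_B \<nu> \<beta> (test_fun k R) x = test_gen \<nu> \<beta> k R x"
proof -
  define N where "N = real CARD('n)"
  define e where "e = esym UNIV (Suc k) (sq x)"
  define e0 where "e0 = esym UNIV k (sq x)"
  define E where "E i = esym (UNIV - {i}) k (sq x)" for i
  define E2 where "E2 i j = esym (UNIV - {i, j}) k (sq x)" for i j
  define h where "h = cutoff 3 R ((norm x)\<^sup>2)"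
  define h1 where "h1 = - 3 / R * cutoff 2 R ((norm x)\<^sup>2)"
  define h2 where "h2 = 6 / R\<^sup>2 * cutoff 1 R ((norm x)\<^sup>2)"
  define q where "q i = E i * h + e * h1" for i
  have grad: "test_grad k R i x = q i" for i
    by (simp add: q_def test_grad_def E_def e_def h_def h1_def)
  have p1: "partial_deriv i (test_fun k R) x = 2 * x $ i * q i" for i
    by (simp add: partial_deriv_test_fun[OF R] grad)
  have p2: "partial_deriv i (partial_deriv i (test_fun k R)) x
      = 2 * q i + 4 * (x $ i)\<^sup>2 * (2 * E i * h1 + e * h2)" for i
    by (simp add: partial_deriv2_test_fun[OF R] grad E_def e_def h1_def h2_def)
  have sum_E: "(\<Sum>i\<in>UNIV. E i) = (N - k) * e0"
    using sum_esym_remove[of "UNIV :: 'n set" k "sq x"] by (simp add: E_def e0_def N_def)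
  have sum_uE: "(\<Sum>i\<in>UNIV. (x $ i)\<^sup>2 * E i) = real (Suc k) * e"
    using esym_Euler[of "UNIV :: 'n set" "sq x" k] by (simp add: E_def e_def)
  have sum_E2: "(\<Sum>i\<in>UNIV. \<Sum>j\<in>UNIV - {i}. E2 i j) = (N - k) * (N - k - 1) * e0"
    using sum_esym_remove2[of "UNIV :: 'n set" k "sq x"] by (simp add: E2_def e0_def N_def)
  have sum_q: "(\<Sum>i\<in>UNIV. q i) = (N - k) * e0 * h + N * e * h1"
    unfolding q_def by (simp add: sum.distrib sum_distrib_right[symmetric] sum_E N_def)
  have diffusion: "1 / 2 * (\<Sum>i\<in>UNIV. partial_deriv i (partial_deriv i (test_fun k R)) x)
      = (N - k) * e0 * h + N * e * h1 + 4 * real (Suc k) * e * h1 + 2 * (norm x)\<^sup>2 * e * h2"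
  proof -
    have "(\<Sum>i\<in>UNIV. 2 * q i + 4 * (x $ i)\<^sup>2 * (2 * E i * h1 + e * h2))
        = 2 * (\<Sum>i\<in>UNIV. q i) + 8 * h1 * (\<Sum>i\<in>UNIV. (x $ i)\<^sup>2 * E i) + 4 * e * h2 * (\<Sum>i\<in>UNIV. (x $ i)\<^sup>2)"
      by (simp add: sum.distrib sum_distrib_left sum_distrib_right algebra_simps)
    then show ?thesis unfolding p2 sum_q sum_uE norm_sq_eq_sum by (simp add: algebra_simps)
  qed
  define T where "T i j = (1 / (x $ i - x $ j) + 1 / (x $ i + x $ j)) * (2 * x $ i * q i)" for i j
  \<comment> \<open>The symmetrized term is 4 times a divided difference of u_i q_i. Its part with
    \<open>h\<close> is \<open>esym_divided_difference\<close>; its part with \<open>h1\<close> is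
    already a multiple of u_i - u_j.\<close>
  have T: "T i j + T j i = 4 * h * E2 i j + 4 * e * h1" if "i \<noteq> j" for i j
  proof -
    have nz: "x $ i - x $ j \<noteq> 0" "x $ i + x $ j \<noteq> 0"
      using ne[OF that] pos[of i] pos[of j] by auto
    then have nz2: "(x $ i)\<^sup>2 - (x $ j)\<^sup>2 \<noteq> 0" by (simp add: square_diff_square_factored power2_eq_square)
    have "T i j = 4 * ((x $ i)\<^sup>2 * q i) / ((x $ i)\<^sup>2 - (x $ j)\<^sup>2)" if "x $ i - x $ j \<noteq> 0" "x $ i + x $ j \<noteq> 0" for i j
    proof -
      have "(x $ i)\<^sup>2 - (x $ j)\<^sup>2 = (x $ i - x $ j) * (x $ i + x $ j)"
        by (simp add: algebra_simps power2_eq_square)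
      then show ?thesis using that by (simp add: T_def divide_simps) (simp add: algebra_simps power2_eq_square)
    qed
    from this[of i j] this[of j i] nz
    have "T i j + T j i = 4 * ((x $ i)\<^sup>2 * q i) / ((x $ i)\<^sup>2 - (x $ j)\<^sup>2)
        + 4 * ((x $ j)\<^sup>2 * q j) / ((x $ j)\<^sup>2 - (x $ i)\<^sup>2)"
      by (simp add: add.commute)
    also have "\<dots> = 4 * ((x $ i)\<^sup>2 * q i - (x $ j)\<^sup>2 * q j) / ((x $ i)\<^sup>2 - (x $ j)\<^sup>2)"
      using nz2 by (simp add: divide_simps) (simp add: algebra_simps)
    also have "(x $ i)\<^sup>2 * q i - (x $ j)\<^sup>2 * q j
        = ((x $ i)\<^sup>2 * E i - (x $ j)\<^sup>2 * E j) * h + ((x $ i)\<^sup>2 - (x $ j)\<^sup>2) * (e * h1)"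
      by (simp add: q_def algebra_simps)
    also have "(x $ i)\<^sup>2 * E i - (x $ j)\<^sup>2 * E j = ((x $ i)\<^sup>2 - (x $ j)\<^sup>2) * E2 i j"
      using esym_divided_difference[of UNIV i j "sq x" k] \<open>i \<noteq> j\<close> by (simp add: E_def E2_def)
    also have "((x $ i)\<^sup>2 - (x $ j)\<^sup>2) * E2 i j * h + ((x $ i)\<^sup>2 - (x $ j)\<^sup>2) * (e * h1)
        = ((x $ i)\<^sup>2 - (x $ j)\<^sup>2) * (h * E2 i j + e * h1)"
      by (simp add: algebra_simps)
    finally show ?thesis using nz2 by simp
  qed
  have "(\<Sum>i\<in>UNIV. \<Sum>j\<in>UNIV - {i}. T i j)
      = 1 / 2 * (\<Sum>i\<in>UNIV. \<Sum>j\<in>UNIV - {i}. 4 * h * E2 i j + 4 * e * h1)"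
    by (subst sum_offdiag_symmetrize) (auto intro!: sum.cong simp: T)
  also have "\<dots> = 2 * h * ((N - k) * (N - k - 1) * e0) + 2 * N * (N - 1) * e * h1"
  proof -
    have "(\<Sum>i\<in>(UNIV :: 'n set). \<Sum>j\<in>UNIV - {i}. 4 * e * h1) = N * (N - 1) * (4 * e * h1)"
      by (simp add: N_def of_nat_diff Suc_leI)
    moreover have "(\<Sum>i\<in>UNIV. \<Sum>j\<in>UNIV - {i}. 4 * h * E2 i j) = 4 * h * ((N - k) * (N - k - 1) * e0)"
      by (simp only: sum_distrib_left[symmetric] sum_E2)
    ultimately show ?thesis by (simp add: sum.distrib)
  qed
  finally have repulsion: "(\<Sum>i\<in>UNIV. \<Sum>j\<in>UNIV - {i}.
         (1 / (x $ i - x $ j) + 1 / (x $ i + x $ j)) * partial_deriv i (test_fun k R) x)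
      = 2 * h * ((N - k) * (N - k - 1) * e0) + 2 * N * (N - 1) * e * h1"
    by (simp add: T_def p1)
  have "(\<Sum>i\<in>UNIV. 1 / x $ i * partial_deriv i (test_fun k R) x) = (\<Sum>i\<in>UNIV. 2 * q i)"
  proof (intro sum.cong refl)
    fix i show "1 / x $ i * partial_deriv i (test_fun k R) x = 2 * q i"
      using pos[of i] by (simp add: p1)
  qed
  then have wall: "(\<Sum>i\<in>UNIV. 1 / x $ i * partial_deriv i (test_fun k R) x) = 2 * ((N - k) * e0 * h + N * e * h1)"
    by (simp add: sum_distrib_left[symmetric] sum_q)
  have "test_gen \<nu> \<beta> k R x = rate TYPE('n) \<nu> \<beta> k * e0 * h
     + e * (((1 + 2 * \<nu> * \<beta>) * N + 4 * real (Suc k) + 2 * \<beta> * N * (N - 1)) * h1 + 2 * (norm x)\<^sup>2 * h2)"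
    by (simp add: test_gen_def e0_def e_def h_def h1_def h2_def N_def)
  then show ?thesis
    unfolding bessel_operator_B_def diffusion repulsion wall
    by (simp add: rate_def N_def[symmetric] algebra_simps)
qed

section \<open>Interior and closure of the Weyl chamber\<close>

lemma interior_weyl_chamber:
  assumes x: "x \<in> interior (weyl_chamber_B :: (real ^ 'n::{finite, linorder}) set)"
  shows "i \<noteq> j \<Longrightarrow> x $ i \<noteq> x $ j" and "0 < x $ i"
proof -
  obtain d where d: "d > 0" "ball x d \<subseteq> weyl_chamber_B"
    using x by (meson mem_interior)
  have mem: "x + s *\<^sub>R axis j 1 \<in> weyl_chamber_B" if "\<bar>s\<bar> < d" for s j
    using that d(2) by (auto simp: dist_norm)
  have neq: "x $ i \<noteq> x $ j" if "i < j" for i j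
  proof -
    \<comment> \<open>Raising the smaller coordinate x_j by d/2 stays in the ball and hence in the
      chamber, so x_j + d/2 <= x_i: a strict gap.\<close>
    have "(x + (d/2) *\<^sub>R axis j 1) $ j \<le> (x + (d/2) *\<^sub>R axis j 1) $ i"
      using mem[of "d/2" j] d(1) less_imp_le[OF that] unfolding weyl_chamber_B_def by (simp only: mem_Collect_eq)
    then show ?thesis using less_imp_neq[OF that] d(1) by (auto simp: axis_def)
  qed
  then show "i \<noteq> j \<Longrightarrow> x $ i \<noteq> x $ j" by (metis linorder_neqE)
  have "0 \<le> (x + (-d/2) *\<^sub>R axis i 1) $ i"
    using mem[of "-d/2" i] d(1) unfolding weyl_chamber_B_def by (simp only: mem_Collect_eq)
  then show "0 < x $ i" using d(1) by (simp add: axis_def)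
qed

lemma interior_weyl_chamberI:
  fixes x :: "real ^ 'n::{finite, linorder}"
  assumes "\<And>i j. i < j \<Longrightarrow> x $ j < x $ i" "\<And>i. 0 < x $ i"
  shows "x \<in> interior weyl_chamber_B"
proof (rule interiorI)
  let ?S = "(\<Inter>i. \<Inter>j\<in>{j. i < j}. {x :: (real, 'n) vec. x $ j < x $ i}) \<inter> (\<Inter>i. {x. 0 < x $ i})"
  show "open ?S"
    by (intro open_Int open_INT ballI open_Collect_less continuous_intros) auto
  show "x \<in> ?S" using assms by auto
  show "?S \<subseteq> weyl_chamber_B"
  proof
    fix y assume y: "y \<in> ?S"
    have "y $ j \<le> y $ i" if "i \<le> j" for i j
      using y that by (cases "i = j") (auto simp: less_le)
    moreover have "0 \<le> y $ i" for i using y by (auto intro: less_imp_le)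
    ultimately show "y \<in> weyl_chamber_B" by (simp add: weyl_chamber_B_def)
  qed
qed

text \<open>At a boundary point this makes the filter within the interior nontrivial, so that the
  \<open>Lim\<close> in \<open>bessel_generator_B\<close> is determined.\<close>

lemma weyl_chamber_subset_closure:
  "(weyl_chamber_B :: (real ^ 'n::{finite, linorder}) set) \<subseteq> closure (interior weyl_chamber_B)"
proof
  fix x :: "(real, 'n) vec" assume x: "x \<in> weyl_chamber_B"
  \<comment> \<open>A point of the open chamber: positive and strictly decreasing in the index.
    Adding a positive multiple of it turns all weak inequalities satisfied by \<open>x\<close> into
    strict ones.\<close>
  define v :: "(real, 'n) vec" where "v = (\<chi> i. 1 + real (card {j. i < j}))"
  have v: "v $ j < v $ i" if "i < j" for i j
  proof -
    have "{k. j < k} \<subset> {k. i < k}" using that by (auto intro: less_trans)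
    then show ?thesis by (simp add: v_def psubset_card_mono)
  qed
  have "x + inverse (real (Suc n)) *\<^sub>R v \<in> interior weyl_chamber_B" for n
  proof (rule interior_weyl_chamberI)
    fix i j :: 'n assume ij: "i < j"
    have "x $ j \<le> x $ i" using x ij by (auto simp: weyl_chamber_B_def)
    moreover have "inverse (real (Suc n)) * v $ j < inverse (real (Suc n)) * v $ i"
      using v[OF ij] by (intro mult_strict_left_mono) auto
    ultimately show "(x + inverse (real (Suc n)) *\<^sub>R v) $ j < (x + inverse (real (Suc n)) *\<^sub>R v) $ i"
      unfolding vector_add_component vector_scaleR_component real_scaleR_def by (rule add_le_less_mono)
  next
    fix i
    have "0 \<le> x $ i" using x by (auto simp: weyl_chamber_B_def)
    moreover have "0 < inverse (real (Suc n)) * v $ i"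
      by (intro mult_pos_pos) (auto simp: v_def)
    ultimately show "0 < (x + inverse (real (Suc n)) *\<^sub>R v) $ i" by simp
  qed
  moreover have "(\<lambda>n. x + inverse (real (Suc n)) *\<^sub>R v) \<longlonglongrightarrow> x + 0 *\<^sub>R v"
    by (intro tendsto_intros LIMSEQ_inverse_real_of_nat)
  ultimately show "x \<in> closure (interior weyl_chamber_B)"
    unfolding closure_sequential by (intro exI[of _ "\<lambda>n. x + inverse (real (Suc n)) *\<^sub>R v"]) auto
qed

lemma continuous_on_esym: "continuous_on S (\<lambda>x :: real ^ 'n::finite. esym A k (sq x))"
  by (rule continuously_differentiable_imp_continuous[OF continuously_differentiable_esym])

lemma continuous_on_test_gen: "R > 0 \<Longrightarrow> continuous_on S (test_gen \<nu> \<beta> k R)"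
  unfolding test_gen_def[abs_def] by (intro continuous_intros continuous_on_esym)

text \<open>\<open>test_gen\<close> is continuous on the whole space and agrees with the operator on
  the interior, so its value is the limit that defines the generator on the boundary.\<close>

lemma bessel_generator_test_fun:
  fixes x :: "real ^ 'n::{finite, linorder}"
  assumes R: "R > 0" and x: "x \<in> weyl_chamber_B"
  shows "bessel_generator_B \<nu> \<beta> (test_fun k R) x = test_gen \<nu> \<beta> k R x"
proof (cases "x \<in> interior weyl_chamber_B")
  case True
  then show ?thesis
    using bessel_operator_test_fun[OF R, of x] interior_weyl_chamber[OF True]
    by (simp add: bessel_generator_B_def)
next
  case False
  let ?F = "at x within interior (weyl_chamber_B :: (real, 'n) vec set)"
  have "(test_gen \<nu> \<beta> k R \<longlongrightarrow> test_gen \<nu> \<beta> k R x) ?F"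
    using continuous_on_test_gen[OF R, of UNIV] tendsto_within_subset[of _ _ x UNIV] by (fastforce simp: continuous_on_def)
  moreover have "\<forall>\<^sub>F y in ?F. test_gen \<nu> \<beta> k R y = bessel_operator_B \<nu> \<beta> (test_fun k R) y"
  proof -
    have "bessel_operator_B \<nu> \<beta> (test_fun k R) y = test_gen \<nu> \<beta> k R y" if "y \<in> interior weyl_chamber_B" for y :: "(real, 'n) vec"
      using bessel_operator_test_fun[OF R, of y] interior_weyl_chamber[OF that] by simp
    then show ?thesis by (simp add: eventually_at_filter)
  qed
  ultimately have "(bessel_operator_B \<nu> \<beta> (test_fun k R) \<longlongrightarrow> test_gen \<nu> \<beta> k R x) ?F"
    using tendsto_cong by force
  moreover have "?F \<noteq> bot"
    using weyl_chamber_subset_closure x False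
    by (auto simp: trivial_limit_within closure_def)
  ultimately show ?thesis
    using False by (simp add: bessel_generator_B_def tendsto_Lim)
qed

text \<open>On the support e_(k+1) <= |x|^2 e_k <= R e_k, which absorbs one factor 1/R. In the term
  with 1/R^2 the second factor is absorbed by |x|^2 / R <= 1. Hence \<open>K\<close> serves for all
  R.\<close>

lemma test_gen_bound:
  assumes "\<nu> \<ge> 0" "\<beta> > 0"
  obtains K where "\<And>R x :: real ^ 'n::finite. R > 0 \<Longrightarrow> \<bar>test_gen \<nu> \<beta> k R x\<bar> \<le> K * esym UNIV k (sq x)"
proof -
  define c where "c = (1 + 2 * \<nu> * \<beta>) * real CARD('n) + 4 * real (Suc k) + 2 * \<beta> * real CARD('n) * (real CARD('n) - 1)"
  define l where "l = rate TYPE('n) \<nu> \<beta> k"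
  \<comment> \<open>The three summands of the constant bound the three terms of
    \<open>test_gen\<close>: \<open>l\<close> the main term, 3 \<open>c\<close> the one with the
    first derivative of the cube, and 12 = 2 * 6 the one with its second derivative.\<close>
  have "\<bar>test_gen \<nu> \<beta> k R x\<bar> \<le> (\<bar>l\<bar> + (3 * \<bar>c\<bar> + 12)) * esym UNIV k (sq x)" if R: "R > 0" for R and x :: "real ^ 'n"
  proof -
    define r where "r = (norm x)\<^sup>2"
    define e where "e = esym UNIV (Suc k) (sq x)"
    define e0 where "e0 = esym UNIV k (sq x)"
    have e: "0 \<le> e" "0 \<le> e0" "e \<le> r * e0"
      using esym_Suc_le[of "UNIV :: 'n set" "sq x" k]
      by (auto simp: e_def e0_def r_def norm_sq_eq_sum intro!: esym_nonneg)
    have r: "0 \<le> r" by (simp add: r_def)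
    have G: "test_gen \<nu> \<beta> k R x = l * e0 * cutoff 3 R r + e * (c * (- 3 / R * cutoff 2 R r) + 2 * r * (6 / R\<^sup>2 * cutoff 1 R r))"
      by (simp add: test_gen_def l_def c_def r_def e_def e0_def)
    show ?thesis
    proof (cases "r < R")
      case False
      then have "test_gen \<nu> \<beta> k R x = 0" using R by (simp add: G cutoff_eq_0)
      then show ?thesis using e(2) by (simp add: e0_def)
    next
      case True
      have c1: "0 \<le> cutoff n R r" "cutoff n R r \<le> 1" for n
        using cutoff_nonneg cutoff_le_1[OF r R] by auto
      have rR: "r / R \<le> 1" "0 \<le> r / R" using True R r by auto
      have "e / R \<le> r / R * e0" using e R by (simp add: divide_right_mono)
      also have "\<dots> \<le> 1 * e0" using rR e by (intro mult_right_mono) auto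
      finally have eR: "e / R \<le> e0" by simp
      have "\<bar>test_gen \<nu> \<beta> k R x\<bar> \<le> \<bar>l * e0 * cutoff 3 R r\<bar> + \<bar>3 * c * (e / R) * cutoff 2 R r\<bar> + \<bar>12 * (r / R) * (e / R) * cutoff 1 R r\<bar>"
        unfolding G by (rule order_trans[OF _ add_mono[OF abs_triangle_ineq4 order_refl, THEN order_trans[OF abs_triangle_ineq]]])
          (simp add: algebra_simps power2_eq_square)
      also have "\<bar>l * e0 * cutoff 3 R r\<bar> \<le> \<bar>l\<bar> * e0"
        using c1[of 3] e by (simp add: abs_mult mult_left_le)
      also have "\<bar>3 * c * (e / R) * cutoff 2 R r\<bar> \<le> 3 * \<bar>c\<bar> * e0 * 1"
        unfolding abs_mult using c1[of 2] eR e R by (intro mult_mono) auto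
      also have "\<bar>12 * (r / R) * (e / R) * cutoff 1 R r\<bar> \<le> 12 * 1 * e0 * 1"
        unfolding abs_mult using c1[of 1] eR e R r rR True by (intro mult_mono) auto
      finally show ?thesis by (simp add: e0_def algebra_simps)
    qed
  qed
  then show thesis by (rule that)
qed

lemma cutoff_tendsto:
  "(\<lambda>m. cutoff n (real (Suc m)) s) \<longlonglongrightarrow> 1"
proof -
  have "(\<lambda>m. max 0 (1 - s * inverse (real (Suc m))) ^ n) \<longlonglongrightarrow> max 0 (1 - s * 0) ^ n"
    by (intro tendsto_intros LIMSEQ_inverse_real_of_nat)
  then show ?thesis by (simp add: cutoff_def divide_inverse)
qed

lemma test_fun_tendsto: "(\<lambda>m. test_fun k (real (Suc m)) x) \<longlonglongrightarrow> esym UNIV (Suc k) (sq x)"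
  unfolding test_fun_def using tendsto_mult[OF tendsto_const cutoff_tendsto] by simp

text \<open>Monotone convergence can then deliver integrability of e_(k+1) at X t, which is not
  known beforehand.\<close>

lemma test_fun_mono: "mono (\<lambda>m. test_fun k (real (Suc m)) x)"
  unfolding test_fun_def cutoff_def
  by (intro monoI mult_left_mono power_mono max.mono diff_left_mono divide_left_mono esym_nonneg) auto

lemma test_gen_tendsto:
  fixes x :: "real ^ 'n::finite"
  shows "(\<lambda>m. test_gen \<nu> \<beta> k (real (Suc m)) x) \<longlonglongrightarrow> rate TYPE('n) \<nu> \<beta> k * esym UNIV k (sq x)"
proof -
  note inv = LIMSEQ_inverse_real_of_nat
  have "(\<lambda>m. rate TYPE('n) \<nu> \<beta> k * esym UNIV k (sq x) * cutoff 3 (real (Suc m)) ((norm x)\<^sup>2)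
     + esym UNIV (Suc k) (sq x) *
       (((1 + 2 * \<nu> * \<beta>) * real CARD('n) + 4 * real (Suc k) + 2 * \<beta> * real CARD('n) * (real CARD('n) - 1))
          * (- 3 * inverse (real (Suc m)) * cutoff 2 (real (Suc m)) ((norm x)\<^sup>2))
        + 2 * (norm x)\<^sup>2 * (6 * (inverse (real (Suc m)))\<^sup>2 * cutoff 1 (real (Suc m)) ((norm x)\<^sup>2))))
    \<longlonglongrightarrow> rate TYPE('n) \<nu> \<beta> k * esym UNIV k (sq x) * 1
     + esym UNIV (Suc k) (sq x) *
       (((1 + 2 * \<nu> * \<beta>) * real CARD('n) + 4 * real (Suc k) + 2 * \<beta> * real CARD('n) * (real CARD('n) - 1))
          * (- 3 * 0 * 1) + 2 * (norm x)\<^sup>2 * (6 * 0\<^sup>2 * 1))"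
    by (intro tendsto_intros inv cutoff_tendsto)
  then show ?thesis by (simp add: test_gen_def divide_inverse power_inverse)
qed

subsection \<open>Moments of the process\<close>

text \<open>Fubini needs joint measurability. The path is the limit of its values at the grid points
  of mesh 1/(m+1) to the left of t, and each discretized map is measurable because the grid index
  takes countably many values.\<close>

lemma continuous_paths_jointly_measurable:
  fixes Y :: "real \<Rightarrow> 'a \<Rightarrow> 'b :: metric_space"
  assumes meas: "\<And>t. Y t \<in> borel_measurable M"
    and cont: "\<And>\<omega>. \<omega> \<in> space M \<Longrightarrow> continuous_on UNIV (\<lambda>t. Y t \<omega>)"
  shows "(\<lambda>(t, \<omega>). Y t \<omega>) \<in> borel_measurable (lborel \<Otimes>\<^sub>M M)"
proof (rule borel_measurable_LIMSEQ_metric)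
  fix m :: nat
  have "(\<lambda>p. (\<lambda>i p. Y (real_of_int i / real (Suc m)) (snd p)) \<lfloor>fst p * real (Suc m)\<rfloor> p)
      \<in> borel_measurable (lborel \<Otimes>\<^sub>M M)"
  proof (rule measurable_compose_countable[where f = "\<lambda>i p. Y (real_of_int i / real (Suc m)) (snd p)"])
    fix i :: int
    show "(\<lambda>p. Y (real_of_int i / real (Suc m)) (snd p)) \<in> borel_measurable (lborel \<Otimes>\<^sub>M M)"
      by (rule measurable_compose[OF measurable_snd meas])
    show "(\<lambda>p. \<lfloor>fst p * real (Suc m)\<rfloor>) \<in> (lborel \<Otimes>\<^sub>M M) \<rightarrow>\<^sub>M count_space UNIV"
      by measurable
  qed
  then show "(\<lambda>p. Y (real_of_int \<lfloor>fst p * real (Suc m)\<rfloor> / real (Suc m)) (snd p)) \<in> borel_measurable (lborel \<Otimes>\<^sub>M M)"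
    by simp
next
  fix p assume p: "p \<in> space (lborel \<Otimes>\<^sub>M M :: (real \<times> 'a) measure)"
  obtain t \<omega> where [simp]: "p = (t, \<omega>)" by force
  have \<omega>: "\<omega> \<in> space M" using p by (simp add: space_pair_measure)
  have "(\<lambda>m. real_of_int \<lfloor>t * real (Suc m)\<rfloor> / real (Suc m)) \<longlonglongrightarrow> t"
  proof (rule LIMSEQ_I)
    fix e :: real assume "e > 0"
    then obtain n where n: "inverse (real (Suc n)) < e" using reals_Archimedean by blast
    show "\<exists>no. \<forall>m\<ge>no. norm (real_of_int \<lfloor>t * real (Suc m)\<rfloor> / real (Suc m) - t) < e"
    proof (intro exI allI impI)
      fix m assume m: "n \<le> m"
      have "real_of_int \<lfloor>t * real (Suc m)\<rfloor> / real (Suc m) - t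
          = (real_of_int \<lfloor>t * real (Suc m)\<rfloor> - t * real (Suc m)) / real (Suc m)"
        by (simp add: field_simps)
      moreover have "\<bar>real_of_int \<lfloor>t * real (Suc m)\<rfloor> - t * real (Suc m)\<bar> \<le> 1" by linarith
      ultimately have "\<bar>real_of_int \<lfloor>t * real (Suc m)\<rfloor> / real (Suc m) - t\<bar> \<le> 1 / real (Suc m)"
        by (simp add: abs_divide divide_right_mono del: of_nat_Suc)
      also have "\<dots> \<le> inverse (real (Suc n))" using m by (simp add: field_simps)
      finally show "norm (real_of_int \<lfloor>t * real (Suc m)\<rfloor> / real (Suc m) - t) < e" using n by simp
    qed
  qed
  then have "(\<lambda>m. Y (real_of_int \<lfloor>t * real (Suc m)\<rfloor> / real (Suc m)) \<omega>) \<longlonglongrightarrow> Y t \<omega>"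
    using cont[OF \<omega>] by (intro continuous_on_tendsto_compose[of UNIV "\<lambda>t. Y t \<omega>"]) auto
  then show "(\<lambda>m. Y (real_of_int \<lfloor>fst p * real (Suc m)\<rfloor> / real (Suc m)) (snd p)) \<longlonglongrightarrow> (case p of (t, \<omega>) \<Rightarrow> Y t \<omega>)"
    by simp
qed

text \<open>The solution of (k+1) c_(k+1) = \<open>rate\<close> c_k with c_0 = 1, the recursion
  shared by process and density.\<close>

definition moment_coeff :: "'n::finite itself \<Rightarrow> real \<Rightarrow> real \<Rightarrow> nat \<Rightarrow> real" where
  "moment_coeff T \<nu> \<beta> k = (\<Prod>j<k. rate T \<nu> \<beta> j / real (Suc j))"

lemma esym_Suc_le_norm:
  "esym UNIV (Suc k) (sq x) \<le> (norm (x :: real ^ 'n::finite))\<^sup>2 * esym UNIV k (sq x)"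
  using esym_Suc_le[of "UNIV :: 'n set" "sq x" k] by (simp add: norm_sq_eq_sum)

lemma esym_sq_nonneg: "0 \<le> esym A k (sq x)"
  by (intro esym_nonneg) simp

text \<open>Integrability of e_k thus passes to the truncated e_(k+1). The factor R is harmless
  because R is fixed whenever this is applied.\<close>

lemma test_fun_le:
  fixes x :: "real ^ 'n::finite"
  assumes "R > 0"
  shows "0 \<le> test_fun k R x" "test_fun k R x \<le> R * esym UNIV k (sq x)"
proof -
  show "0 \<le> test_fun k R x"
    unfolding test_fun_def by (intro mult_nonneg_nonneg esym_sq_nonneg cutoff_nonneg)
  show "test_fun k R x \<le> R * esym UNIV k (sq x)"
  proof (cases "(norm x)\<^sup>2 < R")
    case True
    have "test_fun k R x \<le> esym UNIV (Suc k) (sq x) * 1"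
      unfolding test_fun_def using assms by (intro mult_left_mono esym_sq_nonneg cutoff_le_1) auto
    also have "\<dots> \<le> (norm x)\<^sup>2 * esym UNIV k (sq x)" using esym_Suc_le_norm by simp
    also have "\<dots> \<le> R * esym UNIV k (sq x)"
      using True by (intro mult_right_mono esym_sq_nonneg) auto
    finally show ?thesis .
  next
    case False
    then have "test_fun k R x = 0" using assms by (simp add: test_fun_def cutoff_eq_0)
    then show ?thesis using assms esym_sq_nonneg[of UNIV k x] by simp
  qed
qed

lemma test_fun_0: "test_fun k R (0 :: real ^ 'n::finite) = 0"
proof -
  have "esym UNIV (Suc k) (sq (0 :: real ^ 'n)) = 0"
    using esym_Suc_le_norm[of k "0 :: real ^ 'n"] esym_sq_nonneg[of UNIV "Suc k" "0 :: real ^ 'n"] by simp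
  then show ?thesis by (simp add: test_fun_def)
qed

lemma martingale_expectation:
  assumes "prob_space M" "subalgebra M (F 0)" "martingale_wrt M F Y" "0 \<le> t"
  shows "integrable M (Y t)" "(\<integral>\<omega>. Y t \<omega> \<partial>M) = (\<integral>\<omega>. Y 0 \<omega> \<partial>M)"
proof -
  interpret prob_space M by fact
  interpret finite_measure_subalgebra M "F 0"
    using assms(2) by unfold_locales
  show int: "integrable M (Y t)"
    using assms by (simp add: martingale_wrt_def)
  have "(\<integral>\<omega>. Y t \<omega> \<partial>M) = (\<integral>\<omega>. real_cond_exp M (F 0) (Y t) \<omega> \<partial>M)"
    using real_cond_exp_int(2)[OF int] by simp
  also have "\<dots> = (\<integral>\<omega>. Y 0 \<omega> \<partial>M)"
    using assms by (intro integral_cong_AE) (auto simp: martingale_wrt_def)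
  finally show "(\<integral>\<omega>. Y t \<omega> \<partial>M) = (\<integral>\<omega>. Y 0 \<omega> \<partial>M)" .
qed

text \<open>Dynkin's formula for the start in 0, where \<open>test_fun\<close> vanishes. Replacing
  \<open>X s\<close> by \<open>X (max 0 s)\<close> changes nothing on [0, t] and gives an integrand
  that is jointly measurable over the whole time line.\<close>

lemma bessel_process_test_fun:
  fixes X :: "real \<Rightarrow> 'a \<Rightarrow> real ^ 'n::{finite, linorder}"
  assumes X: "bessel_process_B M \<nu> \<beta> 0 X" and R: "R > 0" and t: "0 \<le> t"
    and int: "integrable M (\<lambda>\<omega>. test_fun k R (X t \<omega>))"
  shows "(\<integral>\<omega>. test_fun k R (X t \<omega>) \<partial>M)
    = (\<integral>\<omega>. (\<integral>s. indicator {0..t} s * test_gen \<nu> \<beta> k R (X (max 0 s) \<omega>) \<partial>lborel) \<partial>M)"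
proof -
  obtain F where F: "\<And>t. subalgebra M (F t)"
    and mart: "\<And>f. twice_continuously_differentiable f \<and> weyl_invariant_B f \<and> compact (closure {x. f x \<noteq> 0}) \<Longrightarrow>
      martingale_wrt M F (\<lambda>t \<omega>. f (X t \<omega>)
             - set_lebesgue_integral lborel {0..t} (\<lambda>s. bessel_generator_B \<nu> \<beta> f (X s \<omega>)))"
    and chamber: "\<And>\<omega> t. \<omega> \<in> space M \<Longrightarrow> 0 \<le> t \<Longrightarrow> X t \<omega> \<in> weyl_chamber_B"
    and start: "AE \<omega> in M. X 0 \<omega> = 0" and M: "prob_space M"
    using X unfolding bessel_process_B_def by blast
  define I where "I t \<omega> = set_lebesgue_integral lborel {0..t} (\<lambda>s. bessel_generator_B \<nu> \<beta> (test_fun k R) (X s \<omega>))" for t \<omega>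
  define Y where "Y t \<omega> = test_fun k R (X t \<omega>) - I t \<omega>" for t \<omega>
  have Y: "martingale_wrt M F Y"
    unfolding Y_def[abs_def] I_def
    by (intro mart conjI twice_continuously_differentiable_test_fun weyl_invariant_test_fun compact_support_test_fun R)
  note E = martingale_expectation[OF M F Y t]
  have I0: "I 0 \<omega> = 0" for \<omega>
  proof -
    have "AE s in lborel. indicator {0..0} s *\<^sub>R bessel_generator_B \<nu> \<beta> (test_fun k R) (X s \<omega>) = 0"
      using AE_lborel_singleton[of "0::real"] by (auto elim!: eventually_mono)
    then show ?thesis unfolding I_def set_lebesgue_integral_def by (rule integral_eq_zero_AE)
  qed
  have "(\<integral>\<omega>. Y t \<omega> \<partial>M) = 0"
    unfolding E(2) using start
    by (intro integral_eq_zero_AE) (auto simp: Y_def I0 test_fun_0)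
  \<comment> \<open>Read off from the martingale property: the time integral is the difference of
    the integrable \<open>test_fun\<close> term and the integrable \<open>Y t\<close>.\<close>
  moreover have "integrable M (I t)"
  proof -
    have "integrable M (\<lambda>\<omega>. test_fun k R (X t \<omega>) - Y t \<omega>)" by (intro Bochner_Integration.integrable_diff int E(1))
    then show ?thesis by (simp add: Y_def)
  qed
  ultimately have "(\<integral>\<omega>. test_fun k R (X t \<omega>) \<partial>M) = (\<integral>\<omega>. I t \<omega> \<partial>M)"
    using int by (simp add: Y_def)
  also have "\<dots> = (\<integral>\<omega>. (\<integral>s. indicator {0..t} s * test_gen \<nu> \<beta> k R (X (max 0 s) \<omega>) \<partial>lborel) \<partial>M)"
    unfolding I_def set_lebesgue_integral_def
    by (intro Bochner_Integration.integral_cong refl)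
      (auto simp: indicator_def bessel_generator_test_fun[OF R chamber])
  finally show ?thesis .
qed

lemma integral_power_Icc:
  assumes "0 \<le> t"
  shows "integrable lborel (\<lambda>s::real. indicator {0..t} s * (c * s ^ k))"
    and "(\<integral>s. indicator {0..t} s * (c * s ^ k) \<partial>lborel) = c * t ^ Suc k / real (Suc k)"
proof -
  have 1: "integrable lborel (\<lambda>s::real. s ^ k * indicator {0..t} s)"
    by (intro borel_integrable_atLeastAtMost) auto
  from integrable_mult_right[OF this, of c]
  show "integrable lborel (\<lambda>s::real. indicator {0..t} s * (c * s ^ k))"
    by (simp add: mult_ac)
  have "(\<integral>s. indicator {0..t} s * (c * s ^ k) \<partial>lborel) = c * (\<integral>s. s ^ k * indicator {0..t} s \<partial>lborel)"
    by (simp add: mult_ac)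
  then show "(\<integral>s. indicator {0..t} s * (c * s ^ k) \<partial>lborel) = c * t ^ Suc k / real (Suc k)"
    using integral_power[OF assms, of k] by simp
qed

text \<open>The induction on k runs over all times at once, since its step integrates the previous
  moment over [0, t].\<close>

lemma bessel_process_moments:
  fixes X :: "real \<Rightarrow> 'a \<Rightarrow> real ^ 'n::{finite, linorder}"
  assumes \<nu>: "\<nu> \<ge> 0" and \<beta>: "\<beta> > 0" and X: "bessel_process_B M \<nu> \<beta> 0 X" and t: "0 \<le> t"
  shows "integrable M (\<lambda>\<omega>. esym UNIV k (sq (X t \<omega>)))"
    and "(\<integral>\<omega>. esym UNIV k (sq (X t \<omega>)) \<partial>M) = moment_coeff TYPE('n) \<nu> \<beta> k * t ^ k"
proof -
  interpret prob_space M using X by (simp add: bessel_process_B_def)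
  interpret pair_sigma_finite lborel M ..
  have XM: "X t \<in> borel_measurable M" if "0 \<le> t" for t
    using X that unfolding bessel_process_B_def by (metis measurable_from_subalg)
  \<comment> \<open>Paths are controlled for nonnegative times only; \<open>max 0 s\<close> freezes
    them at time 0 for negative s and keeps them continuous on the line.\<close>
  have joint [measurable]: "(\<lambda>(s, \<omega>). X (max 0 s) \<omega>) \<in> borel_measurable (lborel \<Otimes>\<^sub>M M)"
  proof (rule continuous_paths_jointly_measurable)
    fix \<omega> assume "\<omega> \<in> space M"
    then have "continuous_on {0..} (\<lambda>t. X t \<omega>)" using X by (simp add: bessel_process_B_def)
    then show "continuous_on UNIV (\<lambda>s. X (max 0 s) \<omega>)"
      by (rule continuous_on_compose2) (auto intro!: continuous_intros)
  qed (simp add: XM)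
  have comp: "(\<lambda>(s, \<omega>). g (X (max 0 s) \<omega>)) \<in> borel_measurable (lborel \<Otimes>\<^sub>M M)"
    if "continuous_on UNIV g" for g :: "(real, 'n) vec \<Rightarrow> real"
    using measurable_compose[OF joint borel_measurable_continuous_onI[OF that]] by (simp add: case_prod_beta')
  have comp_t: "(\<lambda>\<omega>. g (X t \<omega>)) \<in> borel_measurable M"
    if "continuous_on UNIV g" "0 \<le> t" for g :: "(real, 'n) vec \<Rightarrow> real" and t
    using measurable_compose[OF XM borel_measurable_continuous_onI[OF that(1)]] that(2) by simp
  have "integrable M (\<lambda>\<omega>. esym UNIV k (sq (X t \<omega>))) \<and>
    (\<integral>\<omega>. esym UNIV k (sq (X t \<omega>)) \<partial>M) = moment_coeff TYPE('n) \<nu> \<beta> k * t ^ k"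
    using t
  proof (induction k arbitrary: t)
    case 0
    then show ?case by (simp add: esym_0 moment_coeff_def prob_space)
  next
    case (Suc k)
    note t = \<open>0 \<le> t\<close>
    let ?e = "\<lambda>k x. esym UNIV k (sq x)" and ?c = "moment_coeff TYPE('n) \<nu> \<beta> k" and ?l = "rate TYPE('n) \<nu> \<beta> k"
    have IH: "integrable M (\<lambda>\<omega>. ?e k (X s \<omega>))" "(\<integral>\<omega>. ?e k (X s \<omega>) \<partial>M) = ?c * s ^ k" if "0 \<le> s" for s
      using Suc.IH that by auto
    obtain K where K: "\<And>R x :: (real, 'n) vec. R > 0 \<Longrightarrow> \<bar>test_gen \<nu> \<beta> k R x\<bar> \<le> K * ?e k x"
      using test_gen_bound[OF \<nu> \<beta>] by blast
    \<comment> \<open>\<open>D\<close> is e_k along the path up to time t, and \<open>K * D\<close>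
      dominates every \<open>Z m\<close>. Its integral over time and sample space is the integral of
      c_k s^k over [0, t], finite by the induction hypothesis.\<close>
    define D where "D p = indicator {0..t} (fst p) * ?e k (X (max 0 (fst p)) (snd p))" for p
    define Z where "Z m p = indicator {0..t} (fst p) * test_gen \<nu> \<beta> k (real (Suc m)) (X (max 0 (fst p)) (snd p))" for m p
    have D_meas [measurable]: "D \<in> borel_measurable (lborel \<Otimes>\<^sub>M M)"
      using comp[OF continuous_on_esym[of UNIV UNIV k]] unfolding D_def by (simp add: case_prod_beta')
    have Z_meas [measurable]: "Z m \<in> borel_measurable (lborel \<Otimes>\<^sub>M M)" for m
      using comp[OF continuous_on_test_gen[of "real (Suc m)" UNIV \<nu> \<beta> k]] unfolding Z_def by (simp add: case_prod_beta')
    have D_inner: "(\<integral>\<omega>. D (s, \<omega>) \<partial>M) = indicator {0..t} s * (?c * s ^ k)" for s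
      by (auto simp: D_def IH indicator_def)
    have D_nonneg: "0 \<le> D p" for p by (simp add: D_def esym_sq_nonneg)
    have D_int: "integrable (lborel \<Otimes>\<^sub>M M) D"
    proof (rule Fubini_integrable)
      show "integrable lborel (\<lambda>s. \<integral>\<omega>. norm (D (s, \<omega>)) \<partial>M)"
        using integral_power_Icc(1)[OF t, of ?c k] by (simp add: D_nonneg D_inner)
      show "AE s in lborel. integrable M (\<lambda>\<omega>. D (s, \<omega>))"
        by (rule AE_I2) (auto simp: D_def IH indicator_def)
    qed measurable
    have D_val: "integral\<^sup>L (lborel \<Otimes>\<^sub>M M) D = ?c * t ^ Suc k / real (Suc k)"
      using integral_fst'[OF D_int] integral_power_Icc(2)[OF t, of ?c k] by (simp add: D_inner)
    have dom: "norm (Z m p) \<le> K * D p" for m p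
      using K[of "real (Suc m)" "X (max 0 (fst p)) (snd p)"] by (auto simp: Z_def D_def indicator_def)
    have lim: "(\<lambda>m. Z m p) \<longlonglongrightarrow> ?l * D p" for p
      using tendsto_mult[OF tendsto_const test_gen_tendsto, of "indicator {0..t} (fst p)" \<nu> \<beta> k "X (max 0 (fst p)) (snd p)"]
      by (simp add: Z_def D_def mult_ac)
    have KD: "integrable (lborel \<Otimes>\<^sub>M M) (\<lambda>p. K * D p)" using D_int by simp
    have Z_int: "integrable (lborel \<Otimes>\<^sub>M M) (Z m)" for m
      by (rule Bochner_Integration.integrable_bound[OF KD])
        (auto intro!: AE_I2 order_trans[OF dom] simp del: real_norm_def, simp)
    have Z_lim: "(\<lambda>m. integral\<^sup>L (lborel \<Otimes>\<^sub>M M) (Z m)) \<longlonglongrightarrow> integral\<^sup>L (lborel \<Otimes>\<^sub>M M) (\<lambda>p. ?l * D p)"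
      by (rule integral_dominated_convergence[OF _ _ KD]) (use lim dom in auto)
    have f_int: "integrable M (\<lambda>\<omega>. test_fun k (real (Suc m)) (X t \<omega>))" for m
    proof (rule Bochner_Integration.integrable_bound)
      show "integrable M (\<lambda>\<omega>. real (Suc m) * ?e k (X t \<omega>))" using IH(1)[OF t] by simp
      show "(\<lambda>\<omega>. test_fun k (real (Suc m)) (X t \<omega>)) \<in> borel_measurable M"
        by (intro comp_t t continuously_differentiable_imp_continuous continuously_differentiable_test_fun) simp
      show "AE \<omega> in M. norm (test_fun k (real (Suc m)) (X t \<omega>)) \<le> norm (real (Suc m) * ?e k (X t \<omega>))"
      proof (rule AE_I2)
        fix \<omega>
        show "norm (test_fun k (real (Suc m)) (X t \<omega>)) \<le> norm (real (Suc m) * ?e k (X t \<omega>))"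
          using test_fun_le[of "real (Suc m)" k "X t \<omega>"] by (simp add: abs_mult esym_sq_nonneg)
      qed
    qed
    have f_val: "(\<integral>\<omega>. test_fun k (real (Suc m)) (X t \<omega>) \<partial>M) = integral\<^sup>L (lborel \<Otimes>\<^sub>M M) (Z m)" for m
    proof -
      have "integrable (lborel \<Otimes>\<^sub>M M) (\<lambda>(s, \<omega>). Z m (s, \<omega>))" using Z_int by simp
      from integral_snd[OF this]
      have "integral\<^sup>L (lborel \<Otimes>\<^sub>M M) (Z m) = (\<integral>\<omega>. (\<integral>s. Z m (s, \<omega>) \<partial>lborel) \<partial>M)" by simp
      then show ?thesis
        using bessel_process_test_fun[OF X _ t f_int] by (simp add: Z_def)
    qed
    have val: "integral\<^sup>L (lborel \<Otimes>\<^sub>M M) (\<lambda>p. ?l * D p) = moment_coeff TYPE('n) \<nu> \<beta> (Suc k) * t ^ Suc k"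
      using D_val by (simp add: moment_coeff_def)
    have lim_f: "(\<lambda>m. \<integral>\<omega>. test_fun k (real (Suc m)) (X t \<omega>) \<partial>M) \<longlonglongrightarrow> moment_coeff TYPE('n) \<nu> \<beta> (Suc k) * t ^ Suc k"
      using Z_lim unfolding f_val val .
    have meas: "(\<lambda>\<omega>. ?e (Suc k) (X t \<omega>)) \<in> borel_measurable M"
      by (intro comp_t t continuous_on_esym)
    \<comment> \<open>The truncated expectations converge to a finite number, so monotone
      convergence yields integrability of e_(k+1) together with its expectation.\<close>
    note mc = f_int AE_I2[OF test_fun_mono] AE_I2[OF test_fun_tendsto] lim_f meas
    show ?case
      using integrable_monotone_convergence[OF mc] integral_monotone_convergence[OF mc] by blast
  qed
  then show "integrable M (\<lambda>\<omega>. esym UNIV k (sq (X t \<omega>)))"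
    and "(\<integral>\<omega>. esym UNIV k (sq (X t \<omega>)) \<partial>M) = moment_coeff TYPE('n) \<nu> \<beta> k * t ^ k"
    by auto
qed

subsection \<open>Integration by parts against a Gaussian weight\<close>

text \<open>The exponents 1/2, 1/4, 1/8 form a chain: the weight carries 1/2, absorbing a polynomial
  leaves 1/4, and absorbing a translation of length at most 1 leaves 1/8.\<close>

lemma integrable_gaussian:
  "integrable lborel (\<lambda>x :: 'a :: euclidean_space. exp (- (norm x)\<^sup>2 / 8))"
proof (rule integrableI_nonneg)
  have ex: "exp (- (norm x)\<^sup>2 / 8) = (\<Prod>b\<in>Basis. exp (- (x \<bullet> b)\<^sup>2 / 8))" for x :: 'a
  proof -
    have "(norm x)\<^sup>2 = (\<Sum>b\<in>Basis. (x \<bullet> b)\<^sup>2)"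
      unfolding power2_norm_eq_inner by (subst euclidean_inner) (simp add: power2_eq_square)
    then show ?thesis by (simp add: exp_sum[symmetric] sum_negf sum_divide_distrib)
  qed
  \<comment> \<open>The normal density with standard deviation 2 has exponent -x^2/8.\<close>
  have "integrable lborel (\<lambda>x::real. sqrt (2 * pi * 2\<^sup>2) * normal_density 0 2 x)"
    by (intro integrable_mult_right integrable_normal_density) auto
  then have "integrable lborel (\<lambda>x::real. exp (- x\<^sup>2 / 8))"
    by (simp add: normal_density_def)
  then have fin: "(\<integral>\<^sup>+x. ennreal (exp (- x\<^sup>2 / 8)) \<partial>(lborel :: real measure)) < \<infinity>"
    by (simp add: integrable_iff_bounded)
  have "(\<integral>\<^sup>+x. ennreal (exp (- (norm x)\<^sup>2 / 8)) \<partial>(lborel :: 'a measure))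
      = (\<integral>\<^sup>+x. (\<Prod>b\<in>Basis. ennreal (exp (- (x \<bullet> b)\<^sup>2 / 8))) \<partial>(lborel :: 'a measure))"
    unfolding ex by (simp add: prod_ennreal)
  also have "\<dots> = (\<Prod>b\<in>(Basis :: 'a set). \<integral>\<^sup>+x. ennreal (exp (- x\<^sup>2 / 8)) \<partial>(lborel :: real measure))"
    by (rule nn_integral_lborel_prod) auto
  also have "\<dots> < \<infinity>"
    using fin by (simp add: power_less_top_ennreal)
  finally show "(\<integral>\<^sup>+x. ennreal (exp (- (norm x)\<^sup>2 / 8)) \<partial>(lborel :: 'a measure)) < \<infinity>" .
qed auto

lemma integral_translate:
  fixes f :: "'a :: euclidean_space \<Rightarrow> real"
  assumes "integrable lborel f"
  shows "integrable lborel (\<lambda>x. f (x + c))" "(\<integral>x. f (x + c) \<partial>lborel) = (\<integral>x. f x \<partial>lborel)"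
proof -
  have f: "f \<in> borel_measurable borel" using assms by auto
  have "integrable (distr lborel borel ((+) c)) f" using assms by (simp add: lborel_distr_plus)
  then show "integrable lborel (\<lambda>x. f (x + c))"
    using f by (subst (asm) integrable_distr_eq) (auto simp: add.commute)
  have "(\<integral>x. f x \<partial>lborel) = (\<integral>x. f x \<partial>distr lborel borel ((+) c))" by (simp add: lborel_distr_plus)
  also have "\<dots> = (\<integral>x. f (x + c) \<partial>lborel)" using f by (subst integral_distr) (auto simp: add.commute)
  finally show "(\<integral>x. f (x + c) \<partial>lborel) = (\<integral>x. f x \<partial>lborel)" ..
qed

text \<open>Integrability is asked of the scaled function because the density at time t is estimated
  only after scaling it to time 1.\<close>

lemma integral_scale:
  fixes f :: "'a :: euclidean_space \<Rightarrow> real"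
  assumes c: "c > 0" and f: "f \<in> borel_measurable borel"
    and int: "integrable lborel (\<lambda>x. f (c *\<^sub>R x))"
  shows "integrable lborel f" "(\<integral>x. f x \<partial>lborel) = c ^ DIM('a) * (\<integral>x. f (c *\<^sub>R x) \<partial>lborel)"
proof -
  have L: "lborel = density (distr lborel borel (\<lambda>x :: 'a. c *\<^sub>R x)) (\<lambda>_. ennreal (c ^ DIM('a)))"
    using lborel_affine[of c "0 :: 'a"] c by simp
  show "integrable lborel f"
    by (subst L, subst integrable_density) (use c f int in \<open>auto simp: integrable_distr_eq\<close>)
  show "(\<integral>x. f x \<partial>lborel) = c ^ DIM('a) * (\<integral>x. f (c *\<^sub>R x) \<partial>lborel)"
    by (subst L, subst integral_density) (use c f in \<open>auto simp: integral_distr\<close>)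
qed

text \<open>The difference quotients of \<open>F\<close> have integral \<open>0\<close> by translation invariance.\<close>

lemma integral_directional_derivative_eq_0:
  fixes F D :: "'a :: euclidean_space \<Rightarrow> real"
  assumes v: "norm v = 1" and meas [measurable]: "F \<in> borel_measurable borel" "D \<in> borel_measurable borel"
    and deriv: "\<And>x. ((\<lambda>s. F (x + s *\<^sub>R v)) has_real_derivative D x) (at 0)"
    and F: "\<And>x. \<bar>F x\<bar> \<le> C * exp (- (norm x)\<^sup>2 / 4)" and D: "\<And>x. \<bar>D x\<bar> \<le> C * exp (- (norm x)\<^sup>2 / 4)"
  shows "integrable lborel D" "(\<integral>x. D x \<partial>lborel) = 0"
proof -
  have C: "0 \<le> C" using D[of 0] by simp
  have deriv': "((\<lambda>s. F (x + s *\<^sub>R v)) has_real_derivative D (x + s *\<^sub>R v)) (at s)" for x s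
  proof -
    have "((\<lambda>h. F (x + (h + s) *\<^sub>R v)) has_real_derivative D (x + s *\<^sub>R v)) (at 0)"
      using deriv[of "x + s *\<^sub>R v"] by (simp add: scaleR_left_distrib add_ac)
    then show ?thesis using DERIV_shift[of "\<lambda>s. F (x + s *\<^sub>R v)" "D (x + s *\<^sub>R v)" 0 s] by simp
  qed
  \<comment> \<open>For z in [0, 1], |x|^2 <= 2 |x + z v|^2 + 2, so -|x + z v|^2 / 4 <= 1/4 - |x|^2
    / 8. This gives both the constant \<open>exp (1/4)\<close> and the exponent 1/8.\<close>
  define W where "W x = C * exp (1/4) * exp (- (norm x)\<^sup>2 / 8)" for x :: 'a
  have W_int: "integrable lborel W"
    unfolding W_def by (intro integrable_mult_right integrable_gaussian)
  have dom: "\<bar>C * exp (- (norm (x + z *\<^sub>R v))\<^sup>2 / 4)\<bar> \<le> W x" if "0 \<le> z" "z \<le> 1" for x z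
  proof -
    have "norm x \<le> norm (x + z *\<^sub>R v) + norm (z *\<^sub>R v)"
      using norm_triangle_ineq4[of "x + z *\<^sub>R v" "z *\<^sub>R v"] by simp
    then have "norm x \<le> norm (x + z *\<^sub>R v) + 1" using that v by simp
    then have "(norm x)\<^sup>2 \<le> (norm (x + z *\<^sub>R v) + 1)\<^sup>2" by (intro power_mono) auto
    also have "\<dots> \<le> 2 * (norm (x + z *\<^sub>R v))\<^sup>2 + 2"
      using sum_squares_ge_zero[of "norm (x + z *\<^sub>R v) - 1" 0] by (simp add: power2_eq_square algebra_simps)
    finally have "exp (- (norm (x + z *\<^sub>R v))\<^sup>2 / 4) \<le> exp (1/4 + - (norm x)\<^sup>2 / 8)"
      by (subst exp_le_cancel_iff) simp
    then have "exp (- (norm (x + z *\<^sub>R v))\<^sup>2 / 4) \<le> exp (1/4) * exp (- (norm x)\<^sup>2 / 8)"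
      by (simp only: exp_add)
    from mult_left_mono[OF this C] show ?thesis using C by (simp add: W_def mult.assoc)
  qed
  have F_int: "integrable lborel F" and D_int: "integrable lborel D"
  proof -
    have "norm (F x) \<le> norm (W x)" "norm (D x) \<le> norm (W x)" for x
      using order_trans[OF F[of x]] order_trans[OF D[of x]] dom[of 0 x] by (auto simp: abs_le_iff)
    then show "integrable lborel F" "integrable lborel D"
      by (auto intro!: Bochner_Integration.integrable_bound[OF W_int])
  qed
  define h where "h m = inverse (real (Suc m))" for m
  have h: "0 < h m" "h m \<le> 1" for m by (auto simp: h_def field_simps)
  define q where "q m x = (F (x + h m *\<^sub>R v) - F x) / h m" for m x
  have q_meas [measurable]: "q m \<in> borel_measurable borel" for m
    unfolding q_def by measurable
  have q_dom: "\<bar>q m x\<bar> \<le> W x" for m x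
  proof -
    \<comment> \<open>By the mean value theorem the difference quotient is a value of
      \<open>D\<close> at a point shifted by less than 1, so the bound on \<open>D\<close> gives a
      bound independent of m.\<close>
    obtain z where z: "0 < z" "z < h m" "F (x + h m *\<^sub>R v) - F (x + 0 *\<^sub>R v) = (h m - 0) * D (x + z *\<^sub>R v)"
      using MVT2[OF h(1)[of m], of "\<lambda>s. F (x + s *\<^sub>R v)" "\<lambda>s. D (x + s *\<^sub>R v)"] deriv' by blast
    then have "q m x = D (x + z *\<^sub>R v)" using h(1)[of m] by (simp add: q_def)
    also have "\<bar>D (x + z *\<^sub>R v)\<bar> \<le> \<bar>C * exp (- (norm (x + z *\<^sub>R v))\<^sup>2 / 4)\<bar>"
      using D[of "x + z *\<^sub>R v"] by linarith
    also have "\<dots> \<le> W x" using z h(2)[of m] by (intro dom) auto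
    finally show ?thesis .
  qed
  have q_lim: "(\<lambda>m. q m x) \<longlonglongrightarrow> D x" for x
  proof -
    have "((\<lambda>s. (F (x + s *\<^sub>R v) - F x) / s) \<longlongrightarrow> D x) (at 0)"
      using deriv[of x] by (simp add: DERIV_def)
    moreover have "filterlim h (at 0) sequentially"
      using LIMSEQ_inverse_real_of_nat h(1) by (auto simp: filterlim_at h_def[abs_def] less_imp_neq)
    ultimately show ?thesis unfolding q_def by (rule filterlim_compose)
  qed
  have "(\<integral>x. q m x \<partial>lborel) = 0" for m
    unfolding q_def using integral_translate[OF F_int, of "h m *\<^sub>R v"] F_int by simp
  moreover have "(\<lambda>m. \<integral>x. q m x \<partial>lborel) \<longlonglongrightarrow> (\<integral>x. D x \<partial>lborel)"
    by (rule integral_dominated_convergence[OF _ _ W_int]) (use q_lim q_dom in auto)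
  ultimately show "(\<integral>x. D x \<partial>lborel) = 0"
    by (simp add: LIMSEQ_const_iff)
  show "integrable lborel D" by (rule D_int)
qed

text \<open>Polynomial growth in x with constants uniform in the parameter, which is \<epsilon>
  below. The set \<open>S\<close> is a singleton where a bound may degenerate as \<epsilon> tends to
  0, and {0..1} where it must not. The base 1 + |x|^2 is at least 1, so exponents can be enlarged
  freely.\<close>

definition poly_bdd :: "'p set \<Rightarrow> ('p \<Rightarrow> 'a :: real_normed_vector \<Rightarrow> real) \<Rightarrow> bool" where
  "poly_bdd S f \<longleftrightarrow> (\<exists>C m. \<forall>p\<in>S. \<forall>x. \<bar>f p x\<bar> \<le> C * (1 + (norm x)\<^sup>2) ^ m)"

lemma poly_bddI: "(\<And>p x. p \<in> S \<Longrightarrow> \<bar>f p x\<bar> \<le> C * (1 + (norm x)\<^sup>2) ^ m) \<Longrightarrow> poly_bdd S f"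
  unfolding poly_bdd_def by blast

lemma poly_bddE:
  assumes "poly_bdd S f"
  obtains C m where "C \<ge> 0" "\<And>p x. p \<in> S \<Longrightarrow> \<bar>f p x\<bar> \<le> C * (1 + (norm x)\<^sup>2) ^ m"
proof -
  obtain C m where *: "\<And>p x. p \<in> S \<Longrightarrow> \<bar>f p x\<bar> \<le> C * (1 + (norm x)\<^sup>2) ^ m"
    using assms unfolding poly_bdd_def by blast
  show thesis
  proof (rule that)
    show "\<bar>C\<bar> \<ge> 0" by simp
    fix p x assume "p \<in> S"
    then have "\<bar>f p x\<bar> \<le> C * (1 + (norm x)\<^sup>2) ^ m" by (rule *)
    also have "\<dots> \<le> \<bar>C\<bar> * (1 + (norm x)\<^sup>2) ^ m" by (intro mult_right_mono) auto
    finally show "\<bar>f p x\<bar> \<le> \<bar>C\<bar> * (1 + (norm x)\<^sup>2) ^ m" .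
  qed
qed

lemma poly_bdd_le:
  assumes "poly_bdd S g" "\<And>p x. p \<in> S \<Longrightarrow> \<bar>f p x\<bar> \<le> \<bar>g p x\<bar>"
  shows "poly_bdd S f"
  using assms unfolding poly_bdd_def by (meson order_trans)

lemma poly_bdd_const: "poly_bdd S (\<lambda>_ _. c)"
  by (rule poly_bddI[of _ _ "\<bar>c\<bar>" 0]) simp

lemma poly_bdd_param: "poly_bdd {0..1} (\<lambda>p _. p)" "\<epsilon> \<in> {0..1} \<Longrightarrow> poly_bdd {\<epsilon>} (\<lambda>p _. p :: real)"
  by (rule poly_bddI[of _ _ 1 0]; simp)+

lemma poly_bdd_nth: "poly_bdd S (\<lambda>_ x. x $ i)"
proof (rule poly_bddI[of _ _ 1 1])
  fix x :: "real ^ 'b"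
  have "\<bar>x $ i\<bar> \<le> norm x" by (rule component_le_norm_cart)
  also have "\<dots> \<le> 1 + (norm x)\<^sup>2"
  proof -
    have "2 * norm x \<le> 1 + (norm x)\<^sup>2"
      using zero_le_power2[of "norm x - 1"] by (simp add: power2_eq_square algebra_simps)
    then show ?thesis using norm_ge_zero[of x] by linarith
  qed
  finally show "\<bar>x $ i\<bar> \<le> 1 * (1 + (norm x)\<^sup>2) ^ 1" by simp
qed

lemma poly_bdd_add:
  assumes "poly_bdd S f" "poly_bdd S g"
  shows "poly_bdd S (\<lambda>p x. f p x + g p x)"
proof -
  obtain C m where f: "C \<ge> 0" "\<And>p x. p \<in> S \<Longrightarrow> \<bar>f p x\<bar> \<le> C * (1 + (norm x)\<^sup>2) ^ m" using assms(1) by (rule poly_bddE) blast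
  obtain C' m' where g: "C' \<ge> 0" "\<And>p x. p \<in> S \<Longrightarrow> \<bar>g p x\<bar> \<le> C' * (1 + (norm x)\<^sup>2) ^ m'" using assms(2) by (rule poly_bddE) blast
  show ?thesis
  proof (rule poly_bddI)
    fix p x assume p: "p \<in> S"
    have "\<bar>f p x + g p x\<bar> \<le> C * (1 + (norm x)\<^sup>2) ^ m + C' * (1 + (norm x)\<^sup>2) ^ m'"
      using f(2)[OF p, of x] g(2)[OF p, of x] by linarith
    also have "\<dots> \<le> C * (1 + (norm x)\<^sup>2) ^ (m + m') + C' * (1 + (norm x)\<^sup>2) ^ (m + m')"
      using f(1) g(1) by (intro add_mono mult_left_mono power_increasing) auto
    finally show "\<bar>f p x + g p x\<bar> \<le> (C + C') * (1 + (norm x)\<^sup>2) ^ (m + m')" by (simp add: algebra_simps)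
  qed
qed

lemma poly_bdd_mult:
  assumes "poly_bdd S f" "poly_bdd S g"
  shows "poly_bdd S (\<lambda>p x. f p x * g p x)"
proof -
  obtain C m where f: "C \<ge> 0" "\<And>p x. p \<in> S \<Longrightarrow> \<bar>f p x\<bar> \<le> C * (1 + (norm x)\<^sup>2) ^ m" using assms(1) by (rule poly_bddE) blast
  obtain C' m' where g: "C' \<ge> 0" "\<And>p x. p \<in> S \<Longrightarrow> \<bar>g p x\<bar> \<le> C' * (1 + (norm x)\<^sup>2) ^ m'" using assms(2) by (rule poly_bddE) blast
  show ?thesis
  proof (rule poly_bddI)
    fix p x assume p: "p \<in> S"
    have "\<bar>f p x * g p x\<bar> \<le> (C * (1 + (norm x)\<^sup>2) ^ m) * (C' * (1 + (norm x)\<^sup>2) ^ m')"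
      unfolding abs_mult using f g p by (intro mult_mono) auto
    then show "\<bar>f p x * g p x\<bar> \<le> (C * C') * (1 + (norm x)\<^sup>2) ^ (m + m')" by (simp add: power_add mult_ac)
  qed
qed

lemma poly_bdd_uminus: "poly_bdd S f \<Longrightarrow> poly_bdd S (\<lambda>p x. - f p x)"
  by (erule poly_bdd_le) simp

lemma poly_bdd_diff: "poly_bdd S f \<Longrightarrow> poly_bdd S g \<Longrightarrow> poly_bdd S (\<lambda>p x. f p x - g p x)"
  using poly_bdd_add[OF _ poly_bdd_uminus] by fastforce

lemma poly_bdd_power: "poly_bdd S f \<Longrightarrow> poly_bdd S (\<lambda>p x. f p x ^ n)"
  by (induction n) (auto intro: poly_bdd_const poly_bdd_mult)

lemma poly_bdd_sum: "(\<And>i. i \<in> I \<Longrightarrow> poly_bdd S (f i)) \<Longrightarrow> poly_bdd S (\<lambda>p x. \<Sum>i\<in>I. f i p x)"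
  by (induction I rule: infinite_finite_induct) (auto intro: poly_bdd_const poly_bdd_add)

lemma poly_bdd_prod: "(\<And>i. i \<in> I \<Longrightarrow> poly_bdd S (f i)) \<Longrightarrow> poly_bdd S (\<lambda>p x. \<Prod>i\<in>I. f i p x)"
  by (induction I rule: infinite_finite_induct) (auto intro: poly_bdd_const poly_bdd_mult)

text \<open>Adding 1 makes the base at least 1, so the real exponent can be rounded up to a natural
  number.\<close>

lemma poly_bdd_powr:
  assumes "poly_bdd S f" "a \<ge> 0" "\<And>p x. p \<in> S \<Longrightarrow> 0 \<le> f p x"
  shows "poly_bdd S (\<lambda>p x. f p x powr a)"
proof (rule poly_bdd_le)
  show "poly_bdd S (\<lambda>p x. (1 + f p x) ^ nat \<lceil>a\<rceil>)"
    by (intro poly_bdd_power poly_bdd_add poly_bdd_const assms)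
  fix p x assume p: "p \<in> S"
  have "f p x powr a \<le> (1 + f p x) powr a" using assms(2,3) p by (intro powr_mono2) auto
  also have "\<dots> \<le> (1 + f p x) powr real (nat \<lceil>a\<rceil>)"
    using assms(3)[OF p, of x] by (intro powr_mono) linarith+
  also have "\<dots> = (1 + f p x) ^ nat \<lceil>a\<rceil>" using assms(3)[OF p, of x] by (simp add: powr_realpow)
  finally show "\<bar>f p x powr a\<bar> \<le> \<bar>(1 + f p x) ^ nat \<lceil>a\<rceil>\<bar>" by simp
qed

lemma poly_bdd_esym: "poly_bdd S (\<lambda>_ x. esym A k (sq x))"
  unfolding esym_def by (intro poly_bdd_sum poly_bdd_prod poly_bdd_power poly_bdd_nth)

lemmas poly_bdd_intros = poly_bdd_const poly_bdd_param poly_bdd_nth poly_bdd_add poly_bdd_mult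
  poly_bdd_diff poly_bdd_power poly_bdd_sum poly_bdd_prod poly_bdd_esym

lemma poly_bdd_gaussian:
  fixes f :: "'p \<Rightarrow> 'a :: real_normed_vector \<Rightarrow> real"
  assumes "poly_bdd S f"
  obtains C where "\<And>p x. p \<in> S \<Longrightarrow> \<bar>f p x * exp (- (norm x)\<^sup>2 / 2)\<bar> \<le> C * exp (- (norm x)\<^sup>2 / 4)"
proof -
  obtain C m where f: "C \<ge> 0" "\<And>p x. p \<in> S \<Longrightarrow> \<bar>f p x\<bar> \<le> C * (1 + (norm x)\<^sup>2) ^ m"
    using assms by (rule poly_bddE) blast
  \<comment> \<open>Chosen so that \<open>a\<close> >= 1, which gives 1 + r <= a (1 + r/a) <= a exp
    (r/a), and m/a <= 1/4, so that the m-th power costs at most exp (r/4). The summand 4 covers m =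
    0.\<close>
  define a where "a = 4 * real m + 4"
  show thesis
  proof (rule that)
    fix p and x :: 'a assume p: "p \<in> S"
    define r where "r = (norm x)\<^sup>2"
    have r: "0 \<le> r" by (simp add: r_def)
    have "1 + r \<le> a * (1 + r / a)" by (simp add: a_def field_simps)
    also have "\<dots> \<le> a * exp (r / a)" by (intro mult_left_mono exp_ge_add_one_self) (simp add: a_def)
    finally have "(1 + r) ^ m \<le> (a * exp (r / a)) ^ m" using r by (intro power_mono) auto
    also have "\<dots> = a ^ m * exp (real m * (r / a))" by (simp only: power_mult_distrib exp_of_nat_mult)
    also have "\<dots> \<le> a ^ m * exp (r / 4)"
    proof -
      have "real m * (r / a) \<le> r / 4"
        using r by (simp add: a_def field_simps)
      then show ?thesis by (intro mult_left_mono) (auto simp: a_def)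
    qed
    finally have "(1 + r) ^ m * exp (- r / 2) \<le> a ^ m * exp (r / 4) * exp (- r / 2)"
      by (rule mult_right_mono) simp
    also have "\<dots> = a ^ m * exp (- r / 4)" by (simp add: mult.assoc exp_add[symmetric])
    finally have *: "(1 + r) ^ m * exp (- r / 2) \<le> a ^ m * exp (- r / 4)" .
    have "\<bar>f p x * exp (- r / 2)\<bar> \<le> C * (1 + r) ^ m * exp (- r / 2)"
      using f(2)[OF p, of x] by (simp add: abs_mult r_def)
    also have "\<dots> \<le> C * (a ^ m * exp (- r / 4))"
      using mult_left_mono[OF * f(1)] by (simp add: mult.assoc)
    finally show "\<bar>f p x * exp (- (norm x)\<^sup>2 / 2)\<bar> \<le> C * a ^ m * exp (- (norm x)\<^sup>2 / 4)"
      by (simp add: r_def mult.assoc)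
  qed
qed

lemma integrable_gaussian4: "integrable lborel (\<lambda>x :: 'a :: euclidean_space. C * exp (- (norm x)\<^sup>2 / 4))"
proof (intro integrable_mult_right)
  show "integrable lborel (\<lambda>x :: 'a. exp (- (norm x)\<^sup>2 / 4))"
    by (rule Bochner_Integration.integrable_bound[OF integrable_gaussian]) auto
qed

text \<open>The product rule in terms of logarithmic derivatives \<open>d i\<close>. Each is
  specified through \<open>f i a * d i\<close> instead of a quotient, so the factors may
  vanish.\<close>

lemma DERIV_prod_log:
  assumes "\<And>i. i \<in> I \<Longrightarrow> (f i has_real_derivative f i a * d i) (at a)"
  shows "((\<lambda>s. \<Prod>i\<in>I. f i s) has_real_derivative (\<Prod>i\<in>I. f i a) * (\<Sum>i\<in>I. d i)) (at a)"
  using assms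
proof (induction I rule: infinite_finite_induct)
  case (insert j I)
  have "((\<lambda>s. f j s * (\<Prod>i\<in>I. f i s)) has_real_derivative
      f j a * d j * (\<Prod>i\<in>I. f i a) + (\<Prod>i\<in>I. f i a) * (\<Sum>i\<in>I. d i) * f j a) (at a)"
    using insert by (intro DERIV_mult) auto
  then show ?case using insert(1,2) by (simp add: algebra_simps)
qed auto

lemma DERIV_powr_log:
  assumes "(g has_real_derivative d) (at a)" "g a > 0"
  shows "((\<lambda>s. g s powr \<beta>) has_real_derivative g a powr \<beta> * (\<beta> * d / g a)) (at a)"
proof -
  have "((\<lambda>s. exp (\<beta> * ln (g s))) has_real_derivative exp (\<beta> * ln (g a)) * (\<beta> * (d / g a))) (at a)"
    using assms by (auto intro!: derivative_eq_intros)
  then have "((\<lambda>s. exp (\<beta> * ln (g s))) has_real_derivative g a powr \<beta> * (\<beta> * d / g a)) (at a)"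
    using assms by (simp add: powr_def)
  moreover have ev: "\<forall>\<^sub>F s in nhds a. exp (\<beta> * ln (g s)) = g s powr \<beta>"
  proof -
    have "isCont g a" using assms(1) by (rule DERIV_isCont)
    then have "\<forall>\<^sub>F s in at a. g s > 0" using assms(2) by (auto simp: isCont_def dest: order_tendstoD)
    then have "\<forall>\<^sub>F s in nhds a. g s > 0" using assms(2) by (auto simp: eventually_at_filter elim: eventually_mono)
    then show ?thesis by eventually_elim (simp add: powr_def)
  qed
  ultimately show ?thesis using DERIV_cong_ev[OF refl ev refl] by simp
qed

subsection \<open>The regularized weight\<close>

lemma sum_pairs_less:
  fixes g :: "'n::{finite, linorder} \<Rightarrow> 'n \<Rightarrow> real"
  assumes sym: "\<And>i j. g i j = g j i"
  shows "(\<Sum>(i, j)\<in>{(i, j). i < j}. g i j) = 1 / 2 * (\<Sum>i\<in>UNIV. \<Sum>j\<in>UNIV - {i}. g i j)"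
proof -
  let ?P = "{(i, j). i < j} :: ('n \<times> 'n) set" and ?Q = "{(i, j). j < i} :: ('n \<times> 'n) set"
  have "(\<Sum>i\<in>UNIV. \<Sum>j\<in>UNIV - {i}. g i j) = (\<Sum>(i, j)\<in>(SIGMA i:UNIV. UNIV - {i}). g i j)"
    by (simp add: sum.Sigma)
  also have "(SIGMA i:UNIV. UNIV - {i}) = ?P \<union> ?Q" by auto
  also have "(\<Sum>(i, j)\<in>?P \<union> ?Q. g i j) = (\<Sum>(i, j)\<in>?P. g i j) + (\<Sum>(i, j)\<in>?Q. g i j)"
    by (intro sum.union_disjoint) auto
  also have "(\<Sum>(i, j)\<in>?Q. g i j) = (\<Sum>(i, j)\<in>?P. g i j)"
    by (rule sum.reindex_bij_witness[of _ prod.swap prod.swap]) (auto simp: sym)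
  finally show ?thesis by simp
qed

definition poly_weight :: "real \<Rightarrow> real \<Rightarrow> real \<Rightarrow> real ^ 'n::{finite, linorder} \<Rightarrow> real" where
  "poly_weight \<nu> \<beta> \<epsilon> x = (\<Prod>(i, j)\<in>{(i, j). i < j}. (((x $ i)\<^sup>2 - (x $ j)\<^sup>2)\<^sup>2 + \<epsilon>) powr \<beta>)
     * (\<Prod>i\<in>UNIV. ((x $ i)\<^sup>2 + \<epsilon>) powr (\<beta> * \<nu>))"

text \<open>The weight at time 1; other times are reached by scaling. Here \<epsilon> = 0 gives back
  the true density factor.\<close>

definition reg_weight :: "real \<Rightarrow> real \<Rightarrow> real \<Rightarrow> real ^ 'n::{finite, linorder} \<Rightarrow> real" where
  "reg_weight \<nu> \<beta> \<epsilon> x = poly_weight \<nu> \<beta> \<epsilon> x * exp (- (norm x)\<^sup>2 / 2)"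

lemma measurable_poly_weight [measurable]:
  "poly_weight \<nu> \<beta> \<epsilon> \<in> borel_measurable (borel :: (real, 'n::{finite, linorder}) vec measure)"
  unfolding poly_weight_def case_prod_beta' by measurable

lemma measurable_reg_weight [measurable]:
  "reg_weight \<nu> \<beta> \<epsilon> \<in> borel_measurable (borel :: (real, 'n::{finite, linorder}) vec measure)"
  unfolding reg_weight_def by measurable

lemma reg_weight_nonneg: "0 \<le> reg_weight \<nu> \<beta> \<epsilon> x"
  unfolding reg_weight_def poly_weight_def by (intro mult_nonneg_nonneg prod_nonneg) auto

lemma poly_bdd_poly_weight:
  assumes "\<nu> \<ge> 0" "\<beta> > 0" "S \<subseteq> {0..1}"
  shows "poly_bdd S (poly_weight \<nu> \<beta> :: real \<Rightarrow> real ^ 'n::{finite, linorder} \<Rightarrow> real)"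
proof -
  have "poly_bdd {0..1} (poly_weight \<nu> \<beta> :: real \<Rightarrow> (real, 'n) vec \<Rightarrow> real)"
    unfolding poly_weight_def[abs_def] case_prod_beta' using assms
    by (intro poly_bdd_intros poly_bdd_powr) auto
  then show ?thesis using assms(3) unfolding poly_bdd_def by blast
qed

lemma reg_weight_0_eq: "reg_weight \<nu> \<beta> 0 x = unnormalized_density_B \<nu> \<beta> 1 x"
proof -
  \<comment> \<open>At y = 0 both sides are 0, because \<open>0 powr a = 0\<close> for every a; this
    covers the convention for \<nu> = 0.\<close>
  have "(y\<^sup>2) powr a = \<bar>y\<bar> powr (2 * a)" for y a :: real
    by (cases "y = 0") (simp_all add: powr_powr[symmetric] powr_numeral)
  from this[of _ \<beta>] this[of _ "\<beta> * \<nu>"] show ?thesis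
    by (simp add: reg_weight_def poly_weight_def unnormalized_density_B_def mult_ac case_prod_beta')
qed

text \<open>The derivative of the logarithm of \<open>reg_weight\<close> in direction i. The
  conditionals are the derivatives of the squared coordinates in that direction, and
  \<open>- x $ i\<close> comes from the Gaussian.\<close>

definition line_log_deriv :: "real \<Rightarrow> real \<Rightarrow> real \<Rightarrow> 'n \<Rightarrow> real ^ 'n::{finite, linorder} \<Rightarrow> real" where
  "line_log_deriv \<nu> \<beta> \<epsilon> i x =
     (\<Sum>(a, b)\<in>{(a, b). a < b}. \<beta> * (2 * ((x $ a)\<^sup>2 - (x $ b)\<^sup>2)
         * ((if a = i then 2 * x $ a else 0) - (if b = i then 2 * x $ b else 0)))
         / (((x $ a)\<^sup>2 - (x $ b)\<^sup>2)\<^sup>2 + \<epsilon>))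
     + (\<Sum>j\<in>UNIV. \<beta> * \<nu> * (if j = i then 2 * x $ j else 0) / ((x $ j)\<^sup>2 + \<epsilon>)) - x $ i"

lemma DERIV_reg_weight_line:
  fixes x :: "real ^ 'n::{finite, linorder}"
  assumes "\<epsilon> > 0"
  shows "((\<lambda>s. reg_weight \<nu> \<beta> \<epsilon> (x + s *\<^sub>R axis i 1)) has_real_derivative
    reg_weight \<nu> \<beta> \<epsilon> x * line_log_deriv \<nu> \<beta> \<epsilon> i x) (at 0)"
proof -
  define y where "y s = x + s *\<^sub>R axis i 1" for s
  define u' where "u' j = (if j = i then 2 * x $ j else 0)" for j
  have y0: "y 0 = x" by (simp add: y_def)
  have u': "((\<lambda>s. (y s $ j)\<^sup>2) has_real_derivative u' j) (at 0)" for j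
    unfolding y_def u'_def axis_def by (auto intro!: derivative_eq_intros)
  have pos: "0 < t\<^sup>2 + \<epsilon>" for t using assms by (simp add: add_nonneg_pos)
  have pair: "((\<lambda>s. (((y s $ a)\<^sup>2 - (y s $ b)\<^sup>2)\<^sup>2 + \<epsilon>) powr \<beta>) has_real_derivative
      (((y 0 $ a)\<^sup>2 - (y 0 $ b)\<^sup>2)\<^sup>2 + \<epsilon>) powr \<beta> *
        (\<beta> * (2 * ((x $ a)\<^sup>2 - (x $ b)\<^sup>2) * (u' a - u' b)) / (((x $ a)\<^sup>2 - (x $ b)\<^sup>2)\<^sup>2 + \<epsilon>))) (at 0)" for a b
  proof -
    have "((\<lambda>s. ((y s $ a)\<^sup>2 - (y s $ b)\<^sup>2)\<^sup>2 + \<epsilon>) has_real_derivative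
        2 * ((x $ a)\<^sup>2 - (x $ b)\<^sup>2) * (u' a - u' b)) (at 0)"
      using DERIV_add[OF DERIV_power[OF DERIV_diff[OF u'[of a] u'[of b]], of 2] DERIV_const[of \<epsilon>]]
      by (simp add: y0 algebra_simps)
    from DERIV_powr_log[OF this, of \<beta>] show ?thesis using pos by (simp add: y0)
  qed
  have single: "((\<lambda>s. ((y s $ j)\<^sup>2 + \<epsilon>) powr (\<beta> * \<nu>)) has_real_derivative
      ((y 0 $ j)\<^sup>2 + \<epsilon>) powr (\<beta> * \<nu>) * (\<beta> * \<nu> * u' j / ((x $ j)\<^sup>2 + \<epsilon>))) (at 0)" for j
    using DERIV_powr_log[OF DERIV_add[OF u'[of j] DERIV_const[of \<epsilon>]], of "\<beta> * \<nu>"] pos by (simp add: y0)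
  have gauss: "((\<lambda>s. exp (- (norm (y s))\<^sup>2 / 2)) has_real_derivative exp (- (norm x)\<^sup>2 / 2) * (- x $ i)) (at 0)"
    using DERIV_fun_exp[OF DERIV_cdivide[OF DERIV_minus[OF DERIV_norm_sq_line[of x i]], of 2]]
    by (simp add: y_def)
  note deriv = DERIV_mult[OF DERIV_mult[OF
        DERIV_prod_log[of "{(a, b). a < b}" "\<lambda>(a, b) s. (((y s $ a)\<^sup>2 - (y s $ b)\<^sup>2)\<^sup>2 + \<epsilon>) powr \<beta>" 0
          "\<lambda>(a, b). \<beta> * (2 * ((x $ a)\<^sup>2 - (x $ b)\<^sup>2) * (u' a - u' b)) / (((x $ a)\<^sup>2 - (x $ b)\<^sup>2)\<^sup>2 + \<epsilon>)"]
        DERIV_prod_log[OF single]] gauss]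
  show ?thesis
    unfolding reg_weight_def poly_weight_def line_log_deriv_def y_def[symmetric] u'_def[symmetric]
    using deriv pair by (auto simp: case_prod_beta' y0 algebra_simps elim!: DERIV_cong)
qed

lemma poly_bdd_divide:
  assumes "poly_bdd S f" "c > 0" "\<And>p x. p \<in> S \<Longrightarrow> c \<le> g p x"
  shows "poly_bdd S (\<lambda>p x. f p x / g p x)"
proof (rule poly_bdd_le)
  show "poly_bdd S (\<lambda>p x. f p x * (1 / c))" by (intro poly_bdd_intros assms)
  fix p x assume "p \<in> S"
  then have "c \<le> g p x" by (rule assms)
  then have "\<bar>f p x / g p x\<bar> \<le> \<bar>f p x\<bar> / c" using assms(2) by (simp add: abs_divide frac_le)
  then show "\<bar>f p x / g p x\<bar> \<le> \<bar>f p x * (1 / c)\<bar>" using assms(2) by (simp add: abs_mult)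
qed

lemma poly_bdd_if: "poly_bdd S f \<Longrightarrow> poly_bdd S (\<lambda>p x. if P then f p x else 0)"
  by (cases P) (auto intro: poly_bdd_const)

text \<open>The denominators are at least \<epsilon>. The resulting constant grows like
  1/\<epsilon>, which suffices for integrating by parts at a fixed \<epsilon>.\<close>

lemma poly_bdd_line_log_deriv:
  assumes "\<epsilon> > 0"
  shows "poly_bdd {\<epsilon>} (\<lambda>\<epsilon>. line_log_deriv \<nu> \<beta> \<epsilon> i)"
  unfolding line_log_deriv_def[abs_def] case_prod_beta' using assms
  by (intro poly_bdd_intros poly_bdd_if poly_bdd_divide[of _ _ \<epsilon>]) auto

text \<open>The divergence of w V divided by the weight w, where V has the components x_i e_k
  (without i), that is, half the gradient of e_(k+1) of the squares. After pairing, the singular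
  quotients have the form s^2/(s^2 + \<epsilon>).\<close>

definition symm_log_deriv :: "real \<Rightarrow> real \<Rightarrow> nat \<Rightarrow> real \<Rightarrow> real ^ 'n::{finite, linorder} \<Rightarrow> real" where
  "symm_log_deriv \<nu> \<beta> k \<epsilon> x = (real CARD('n) - real k) * esym UNIV k (sq x)
     + (\<Sum>(a, b)\<in>{(a, b). a < b}. 4 * \<beta> * esym (UNIV - {a, b}) k (sq x)
         * (((x $ a)\<^sup>2 - (x $ b)\<^sup>2)\<^sup>2 / (((x $ a)\<^sup>2 - (x $ b)\<^sup>2)\<^sup>2 + \<epsilon>)))
     + (\<Sum>j\<in>UNIV. 2 * \<beta> * \<nu> * esym (UNIV - {j}) k (sq x) * ((x $ j)\<^sup>2 / ((x $ j)\<^sup>2 + \<epsilon>)))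
     - real (Suc k) * esym UNIV (Suc k) (sq x)"

text \<open>Exchanging the sums, a pair (a, b) receives only the contributions i = a and i = b. By
  \<open>esym_divided_difference\<close> they combine to a multiple of x_a^2 - x_b^2, which squares
  the numerator. Euler's relation produces the last term.\<close>

lemma sum_line_log_deriv:
  fixes x :: "real ^ 'n::{finite, linorder}"
  shows "(\<Sum>i\<in>UNIV. esym (UNIV - {i}) k (sq x) + x $ i * esym (UNIV - {i}) k (sq x) * line_log_deriv \<nu> \<beta> \<epsilon> i x)
    = symm_log_deriv \<nu> \<beta> k \<epsilon> x"
proof -
  define E where "E i = esym (UNIV - {i}) k (sq x)" for i
  define Q where "Q a b = ((x $ a)\<^sup>2 - (x $ b)\<^sup>2)\<^sup>2 + \<epsilon>" for a b
  define G where "G i a b = (if a = i then 2 * x $ a else 0) - (if b = i then 2 * x $ b else (0 :: real))" for i a b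
  have delta: "(\<Sum>i\<in>UNIV. x $ i * E i * (if a = i then 2 * x $ a else 0)) = 2 * ((x $ a)\<^sup>2 * E a)" for a
  proof -
    have "(\<Sum>i\<in>UNIV. x $ i * E i * (if a = i then 2 * x $ a else 0))
        = (\<Sum>i\<in>UNIV. if a = i then 2 * ((x $ a)\<^sup>2 * E a) else 0)"
      by (intro sum.cong) (auto simp: power2_eq_square)
    then show ?thesis by simp
  qed
  have pairs: "(\<Sum>i\<in>UNIV. x $ i * E i * (\<Sum>(a, b)\<in>{(a, b). a < b}. \<beta> * (2 * ((x $ a)\<^sup>2 - (x $ b)\<^sup>2) * G i a b) / Q a b))
      = (\<Sum>(a, b)\<in>{(a, b). a < b}. 4 * \<beta> * esym (UNIV - {a, b}) k (sq x) * (((x $ a)\<^sup>2 - (x $ b)\<^sup>2)\<^sup>2 / Q a b))"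
  proof -
    have "(\<Sum>i\<in>UNIV. x $ i * E i * (\<Sum>(a, b)\<in>{(a, b). a < b}. \<beta> * (2 * ((x $ a)\<^sup>2 - (x $ b)\<^sup>2) * G i a b) / Q a b))
        = (\<Sum>(a, b)\<in>{(a, b). a < b}. \<beta> * (2 * ((x $ a)\<^sup>2 - (x $ b)\<^sup>2)) / Q a b * (\<Sum>i\<in>UNIV. x $ i * E i * G i a b))"
      unfolding sum_distrib_left case_prod_beta' by (subst sum.swap) (simp add: mult_ac)
    also have "\<dots> = (\<Sum>(a, b)\<in>{(a, b). a < b}. 4 * \<beta> * esym (UNIV - {a, b}) k (sq x) * (((x $ a)\<^sup>2 - (x $ b)\<^sup>2)\<^sup>2 / Q a b))"
    proof (intro sum.cong refl, safe)
      fix a b :: 'n assume "a < b"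
      have "(\<Sum>i\<in>UNIV. x $ i * E i * G i a b) = 2 * ((x $ a)\<^sup>2 * E a - (x $ b)\<^sup>2 * E b)"
        unfolding G_def right_diff_distrib sum_subtractf delta by simp
      also have "(x $ a)\<^sup>2 * E a - (x $ b)\<^sup>2 * E b = ((x $ a)\<^sup>2 - (x $ b)\<^sup>2) * esym (UNIV - {a, b}) k (sq x)"
        using esym_divided_difference[of UNIV a b "sq x" k] \<open>a < b\<close> by (simp add: E_def)
      finally have "(\<Sum>i\<in>UNIV. x $ i * E i * G i a b) = 2 * (((x $ a)\<^sup>2 - (x $ b)\<^sup>2) * esym (UNIV - {a, b}) k (sq x))" .
      then show "\<beta> * (2 * ((x $ a)\<^sup>2 - (x $ b)\<^sup>2)) / Q a b * (\<Sum>i\<in>UNIV. x $ i * E i * G i a b)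
          = 4 * \<beta> * esym (UNIV - {a, b}) k (sq x) * (((x $ a)\<^sup>2 - (x $ b)\<^sup>2)\<^sup>2 / Q a b)"
        by (simp add: power2_eq_square[of "(x $ a)\<^sup>2 - (x $ b)\<^sup>2"])
    qed
    finally show ?thesis .
  qed
  have singles: "(\<Sum>i\<in>UNIV. x $ i * E i * (\<Sum>j\<in>UNIV. \<beta> * \<nu> * (if j = i then 2 * x $ j else 0) / ((x $ j)\<^sup>2 + \<epsilon>)))
      = (\<Sum>j\<in>UNIV. 2 * \<beta> * \<nu> * E j * ((x $ j)\<^sup>2 / ((x $ j)\<^sup>2 + \<epsilon>)))"
  proof (intro sum.cong refl)
    fix i
    have "(\<Sum>j\<in>UNIV. \<beta> * \<nu> * (if j = i then 2 * x $ j else 0) / ((x $ j)\<^sup>2 + \<epsilon>))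
        = (\<Sum>j\<in>UNIV. if j = i then \<beta> * \<nu> * (2 * x $ i) / ((x $ i)\<^sup>2 + \<epsilon>) else 0)"
      by (intro sum.cong) auto
    then show "x $ i * E i * (\<Sum>j\<in>UNIV. \<beta> * \<nu> * (if j = i then 2 * x $ j else 0) / ((x $ j)\<^sup>2 + \<epsilon>))
        = 2 * \<beta> * \<nu> * E i * ((x $ i)\<^sup>2 / ((x $ i)\<^sup>2 + \<epsilon>))"
      by (simp add: power2_eq_square)
  qed
  have euler: "(\<Sum>i\<in>UNIV. x $ i * E i * x $ i) = real (Suc k) * esym UNIV (Suc k) (sq x)"
    using esym_Euler[of "UNIV :: 'n set" "sq x" k] by (simp add: E_def power2_eq_square mult_ac)
  have "(\<Sum>i\<in>UNIV. E i + x $ i * E i * line_log_deriv \<nu> \<beta> \<epsilon> i x)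
      = (\<Sum>i\<in>UNIV. E i)
        + (\<Sum>i\<in>UNIV. x $ i * E i * (\<Sum>(a, b)\<in>{(a, b). a < b}. \<beta> * (2 * ((x $ a)\<^sup>2 - (x $ b)\<^sup>2) * G i a b) / Q a b))
        + (\<Sum>i\<in>UNIV. x $ i * E i * (\<Sum>j\<in>UNIV. \<beta> * \<nu> * (if j = i then 2 * x $ j else 0) / ((x $ j)\<^sup>2 + \<epsilon>)))
        - (\<Sum>i\<in>UNIV. x $ i * E i * x $ i)"
    unfolding line_log_deriv_def G_def Q_def by (simp only: sum.distrib sum_subtractf distrib_left right_diff_distrib add_diff_eq add.assoc)
  then show ?thesis
    unfolding pairs singles euler symm_log_deriv_def
    using sum_esym_remove[of "UNIV :: 'n set" k "sq x"] by (simp add: E_def Q_def)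
qed

lemma measurable_esym_sq [measurable]: "(\<lambda>x :: real ^ 'n::finite. esym A k (sq x)) \<in> borel_measurable borel"
  by (intro borel_measurable_continuous_onI continuous_on_esym)

lemma measurable_line_log_deriv [measurable]:
  "line_log_deriv \<nu> \<beta> \<epsilon> i \<in> borel_measurable (borel :: (real, 'n::{finite, linorder}) vec measure)"
  unfolding line_log_deriv_def case_prod_beta' by measurable

text \<open>The integrand is a divergence: \<open>F i\<close> is the i-th component of the weighted
  field and \<open>D i\<close> its derivative in direction i, each of integral 0. The Gaussian
  bounds on them may depend on \<epsilon>, which is fixed here.\<close>

lemma integral_symm_log_deriv:
  assumes "\<nu> \<ge> 0" "\<beta> > 0" "0 < \<epsilon>" "\<epsilon> \<le> 1"
  shows "(\<integral>x. reg_weight \<nu> \<beta> \<epsilon> x * symm_log_deriv \<nu> \<beta> k \<epsilon> x \<partial>(lborel :: (real, 'n::{finite, linorder}) vec measure)) = 0"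
proof -
  define F where "F i x = x $ i * esym (UNIV - {i}) k (sq x) * reg_weight \<nu> \<beta> \<epsilon> x" for i and x :: "(real, 'n) vec"
  define D where "D i x = (esym (UNIV - {i}) k (sq x) + x $ i * esym (UNIV - {i}) k (sq x) * line_log_deriv \<nu> \<beta> \<epsilon> i x)
      * reg_weight \<nu> \<beta> \<epsilon> x" for i and x :: "(real, 'n) vec"
  note pb = poly_bdd_poly_weight[OF assms(1,2), of "{\<epsilon>}"]
  have part: "integrable lborel (D i)" "(\<integral>x. D i x \<partial>lborel) = 0" for i
  proof -
    have pF: "poly_bdd {\<epsilon>} (\<lambda>\<epsilon> x :: (real, 'n) vec. x $ i * esym (UNIV - {i}) k (sq x) * poly_weight \<nu> \<beta> \<epsilon> x)"
      using assms by (intro poly_bdd_intros pb) auto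
    have pD: "poly_bdd {\<epsilon>} (\<lambda>\<epsilon> x :: (real, 'n) vec. (esym (UNIV - {i}) k (sq x) + x $ i * esym (UNIV - {i}) k (sq x) * line_log_deriv \<nu> \<beta> \<epsilon> i x)
        * poly_weight \<nu> \<beta> \<epsilon> x)"
      using assms by (intro poly_bdd_intros pb poly_bdd_line_log_deriv) auto
    obtain C where C: "\<And>x. \<bar>F i x\<bar> \<le> C * exp (- (norm x)\<^sup>2 / 4)"
      using pF by (rule poly_bdd_gaussian) (auto simp: F_def reg_weight_def mult.assoc)
    obtain C' where C': "\<And>x. \<bar>D i x\<bar> \<le> C' * exp (- (norm x)\<^sup>2 / 4)"
      using pD by (rule poly_bdd_gaussian) (auto simp: D_def reg_weight_def mult.assoc)
    have max: "\<bar>F i x\<bar> \<le> max C C' * exp (- (norm x)\<^sup>2 / 4)" "\<bar>D i x\<bar> \<le> max C C' * exp (- (norm x)\<^sup>2 / 4)" for x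
      by (rule order_trans[OF C] order_trans[OF C'], simp)+
    have deriv: "((\<lambda>s. F i (x + s *\<^sub>R axis i 1)) has_real_derivative D i x) (at 0)" for x
    proof -
      have l: "((\<lambda>s. (x + s *\<^sub>R axis i 1) $ i) has_real_derivative 1) (at 0)"
        by (auto intro!: derivative_eq_intros simp: axis_def)
      show ?thesis
        unfolding F_def DERIV_esym_line(2)
        by (rule DERIV_cong[OF DERIV_mult[OF DERIV_mult[OF l DERIV_const] DERIV_reg_weight_line[OF assms(3)]]])
          (simp add: D_def algebra_simps)
    qed
    have v: "norm (axis i 1 :: (real, 'n) vec) = 1" by (simp add: norm_axis_1)
    have m: "F i \<in> borel_measurable borel" "D i \<in> borel_measurable borel"
      unfolding F_def D_def by measurable
    show "integrable lborel (D i)" "(\<integral>x. D i x \<partial>lborel) = 0"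
      by (rule integral_directional_derivative_eq_0[OF v m deriv max])+
  qed
  have "(\<integral>x. reg_weight \<nu> \<beta> \<epsilon> x * symm_log_deriv \<nu> \<beta> k \<epsilon> x \<partial>(lborel :: (real, 'n) vec measure)) = (\<integral>x. (\<Sum>i\<in>UNIV. D i x) \<partial>lborel)"
    unfolding sum_line_log_deriv[symmetric] D_def by (simp add: sum_distrib_left sum_distrib_right mult_ac)
  also have "\<dots> = 0" using part by (simp add: Bochner_Integration.integral_sum)
  finally show ?thesis .
qed

subsection \<open>Moments of the density\<close>

text \<open>The excluded points lie on the finitely many hyperplanes x_i = 0 and x_a = x_b or x_a =
  -x_b.\<close>

lemma AE_regular:
  "AE x in (lborel :: (real, 'n::finite) vec measure). (\<forall>i. x $ i \<noteq> 0) \<and> (\<forall>a b. a \<noteq> b \<longrightarrow> (x $ a)\<^sup>2 \<noteq> (x $ b)\<^sup>2)"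
proof -
  have hyper: "AE x in (lborel :: (real, 'n) vec measure). v \<bullet> x \<noteq> 0" if "v \<noteq> 0" for v
  proof -
    have "{x :: (real, 'n) vec. v \<bullet> x = 0} \<in> sets lborel" by measurable
    then have "{x :: (real, 'n) vec. v \<bullet> x = 0} \<in> null_sets lborel"
      using negligible_hyperplane[of v 0] that by (simp add: negligible_iff_null_sets null_sets_completion_iff)
    then show ?thesis by (rule AE_I') auto
  qed
  have "AE x in (lborel :: (real, 'n) vec measure). x $ i \<noteq> 0" for i
    using hyper[of "axis i 1"] by (simp add: inner_axis')
  moreover have "AE x in (lborel :: (real, 'n) vec measure). a \<noteq> b \<longrightarrow> (x $ a)\<^sup>2 \<noteq> (x $ b)\<^sup>2" for a b
  proof (cases "a = b")
    case False
    have "axis a 1 - axis b 1 \<noteq> (0 :: (real, 'n) vec)" "axis a 1 + axis b 1 \<noteq> (0 :: (real, 'n) vec)"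
      using False by (auto simp: vec_eq_iff axis_def intro!: exI[of _ a])
    from this[THEN hyper] show ?thesis
      by eventually_elim (auto simp: inner_diff_left inner_add_left inner_axis' power2_eq_iff)
  qed simp
  ultimately show ?thesis by (simp add: AE_all_countable)
qed

text \<open>In contrast to \<open>line_log_deriv\<close>, the only quotients left lie in [0, 1], so
  the bound is uniform down to \<epsilon> = 0 and can serve as a dominating function.\<close>

lemma poly_bdd_symm_log_deriv:
  "poly_bdd {0..1} (symm_log_deriv \<nu> \<beta> k :: real \<Rightarrow> real ^ 'n::{finite, linorder} \<Rightarrow> real)"
proof -
  have ratio: "poly_bdd {0..1} (\<lambda>\<epsilon> x :: (real, 'n) vec. (f x)\<^sup>2 / ((f x)\<^sup>2 + \<epsilon>))" for f :: "(real, 'n) vec \<Rightarrow> real"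
  proof (rule poly_bdd_le[OF poly_bdd_const[of _ 1]])
    fix \<epsilon> :: real and x assume "\<epsilon> \<in> {0..1}"
    then have "0 \<le> \<epsilon>" by simp
    then show "\<bar>(f x)\<^sup>2 / ((f x)\<^sup>2 + \<epsilon>)\<bar> \<le> \<bar>1\<bar>"
      \<comment> \<open>If the square and \<epsilon> both vanish, the quotient is 0/0 = 0.\<close>
      by (cases "(f x)\<^sup>2 + \<epsilon> = 0") (simp_all add: abs_divide divide_le_eq_1 order.strict_iff_order)
  qed
  show ?thesis
    unfolding symm_log_deriv_def[abs_def] case_prod_beta'
    by (intro poly_bdd_intros ratio)
qed

text \<open>All quotients equal 1. Each pair a < b stands for two ordered pairs, so the counting
  identities add up to the same \<open>rate\<close> that the generator produced.\<close>

lemma symm_log_deriv_0: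
  fixes x :: "real ^ 'n::{finite, linorder}"
  assumes "\<And>i. x $ i \<noteq> 0" "\<And>a b. a \<noteq> b \<Longrightarrow> (x $ a)\<^sup>2 \<noteq> (x $ b)\<^sup>2"
  shows "symm_log_deriv \<nu> \<beta> k 0 x
    = rate TYPE('n) \<nu> \<beta> k * esym UNIV k (sq x) - real (Suc k) * esym UNIV (Suc k) (sq x)"
proof -
  have "(\<Sum>(a, b)\<in>{(a, b). a < b}. 4 * \<beta> * esym (UNIV - {a, b}) k (sq x)
         * (((x $ a)\<^sup>2 - (x $ b)\<^sup>2)\<^sup>2 / (((x $ a)\<^sup>2 - (x $ b)\<^sup>2)\<^sup>2 + 0)))
      = (\<Sum>(a, b)\<in>{(a, b). a < b}. 4 * \<beta> * esym (UNIV - {a, b}) k (sq x))"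
    using assms(2) by (intro sum.cong refl) auto
  also have "\<dots> = 1 / 2 * (\<Sum>a\<in>UNIV. \<Sum>b\<in>UNIV - {a}. 4 * \<beta> * esym (UNIV - {a, b}) k (sq x))"
    by (rule sum_pairs_less) (simp add: insert_commute)
  also have "\<dots> = 2 * \<beta> * ((real CARD('n) - real k) * (real CARD('n) - real k - 1) * esym UNIV k (sq x))"
    unfolding sum_distrib_left[symmetric] sum_esym_remove2[OF finite] by simp
  finally have 1: "(\<Sum>(a, b)\<in>{(a, b). a < b}. 4 * \<beta> * esym (UNIV - {a, b}) k (sq x)
         * (((x $ a)\<^sup>2 - (x $ b)\<^sup>2)\<^sup>2 / (((x $ a)\<^sup>2 - (x $ b)\<^sup>2)\<^sup>2 + 0)))
      = 2 * \<beta> * ((real CARD('n) - real k) * (real CARD('n) - real k - 1) * esym UNIV k (sq x))" .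
  have 2: "(\<Sum>j\<in>UNIV. 2 * \<beta> * \<nu> * esym (UNIV - {j}) k (sq x) * ((x $ j)\<^sup>2 / ((x $ j)\<^sup>2 + 0)))
      = 2 * \<beta> * \<nu> * ((real CARD('n) - real k) * esym UNIV k (sq x))"
    using assms(1) sum_esym_remove[of "UNIV :: 'n set" k "sq x"] by (simp add: sum_distrib_left[symmetric])
  show ?thesis unfolding symm_log_deriv_def 1 2 rate_def by (simp add: algebra_simps)
qed

text \<open>Off the exceptional hyperplanes the bases of \<open>powr\<close> and the denominators
  have nonzero limits, as continuity of these operations requires.\<close>

lemma reg_weight_symm_tendsto:
  fixes x :: "real ^ 'n::{finite, linorder}"
  assumes "\<And>i. x $ i \<noteq> 0" "\<And>a b. a \<noteq> b \<Longrightarrow> (x $ a)\<^sup>2 \<noteq> (x $ b)\<^sup>2" "h \<longlonglongrightarrow> 0"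
  shows "(\<lambda>m. reg_weight \<nu> \<beta> (h m) x * symm_log_deriv \<nu> \<beta> k (h m) x)
    \<longlonglongrightarrow> reg_weight \<nu> \<beta> 0 x * symm_log_deriv \<nu> \<beta> k 0 x"
  unfolding reg_weight_def poly_weight_def symm_log_deriv_def case_prod_beta'
  by (intro tendsto_intros assms(3)) (use assms(1,2) in auto)

lemma integrable_weight_esym:
  assumes "\<nu> \<ge> 0" "\<beta> > 0"
  shows "integrable lborel (\<lambda>x :: (real, 'n::{finite, linorder}) vec. reg_weight \<nu> \<beta> 0 x * esym UNIV k (sq x))"
proof -
  have "poly_bdd {0} (\<lambda>\<epsilon> x :: (real, 'n) vec. esym UNIV k (sq x) * poly_weight \<nu> \<beta> \<epsilon> x)"
    using assms by (intro poly_bdd_intros poly_bdd_poly_weight) auto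
  then obtain C where C: "\<And>x :: (real, 'n) vec. \<bar>reg_weight \<nu> \<beta> 0 x * esym UNIV k (sq x)\<bar> \<le> C * exp (- (norm x)\<^sup>2 / 4)"
    by (rule poly_bdd_gaussian) (auto simp: reg_weight_def mult_ac)
  show ?thesis
  proof (rule Bochner_Integration.integrable_bound[OF integrable_gaussian4[of C]])
    show "AE x in (lborel :: (real, 'n) vec measure). norm (reg_weight \<nu> \<beta> 0 x * esym UNIV k (sq x)) \<le> norm (C * exp (- (norm x)\<^sup>2 / 4))"
      by (intro AE_I2) (use C in \<open>auto intro: order_trans[OF _ abs_ge_self] simp del: abs_mult\<close>)
  qed measurable
qed

lemma weight_moment_recursion:
  assumes "\<nu> \<ge> 0" "\<beta> > 0"
  shows "real (Suc k) * (\<integral>x. reg_weight \<nu> \<beta> 0 x * esym UNIV (Suc k) (sq x) \<partial>(lborel :: (real, 'n::{finite, linorder}) vec measure))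
    = rate TYPE('n) \<nu> \<beta> k * (\<integral>x. reg_weight \<nu> \<beta> 0 x * esym UNIV k (sq x) \<partial>(lborel :: (real, 'n) vec measure))"
proof -
  have "poly_bdd {0..1} (\<lambda>\<epsilon> x :: (real, 'n) vec. symm_log_deriv \<nu> \<beta> k \<epsilon> x * poly_weight \<nu> \<beta> \<epsilon> x)"
    using assms by (intro poly_bdd_mult poly_bdd_symm_log_deriv poly_bdd_poly_weight) auto
  then obtain C where C: "\<And>\<epsilon> x :: (real, 'n) vec. \<epsilon> \<in> {0..1} \<Longrightarrow>
      \<bar>reg_weight \<nu> \<beta> \<epsilon> x * symm_log_deriv \<nu> \<beta> k \<epsilon> x\<bar> \<le> C * exp (- (norm x)\<^sup>2 / 4)"
    by (rule poly_bdd_gaussian) (auto simp: reg_weight_def mult_ac)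
  define h where "h m = inverse (real (Suc m))" for m
  have h: "0 < h m" "h m \<le> 1" "h \<longlonglongrightarrow> 0" for m
    using LIMSEQ_inverse_real_of_nat by (auto simp: h_def[abs_def] field_simps)
  have symm_meas [measurable]: "symm_log_deriv \<nu> \<beta> k \<epsilon> \<in> borel_measurable (borel :: (real, 'n) vec measure)" for \<epsilon>
    unfolding symm_log_deriv_def case_prod_beta' by measurable
  have "(\<lambda>m. \<integral>x. reg_weight \<nu> \<beta> (h m) x * symm_log_deriv \<nu> \<beta> k (h m) x \<partial>(lborel :: (real, 'n) vec measure))
      \<longlonglongrightarrow> (\<integral>x. reg_weight \<nu> \<beta> 0 x * symm_log_deriv \<nu> \<beta> k 0 x \<partial>(lborel :: (real, 'n) vec measure))"
  proof (rule integral_dominated_convergence[where w = "\<lambda>x. C * exp (- (norm x)\<^sup>2 / 4)"])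
    show "integrable lborel (\<lambda>x :: (real, 'n) vec. C * exp (- (norm x)\<^sup>2 / 4))"
      by (rule integrable_gaussian4)
    show "AE x in (lborel :: (real, 'n) vec measure). (\<lambda>m. reg_weight \<nu> \<beta> (h m) x * symm_log_deriv \<nu> \<beta> k (h m) x)
        \<longlonglongrightarrow> reg_weight \<nu> \<beta> 0 x * symm_log_deriv \<nu> \<beta> k 0 x"
      using AE_regular by eventually_elim (rule reg_weight_symm_tendsto, auto simp: h)
    show "AE x in (lborel :: (real, 'n) vec measure). norm (reg_weight \<nu> \<beta> (h m) x * symm_log_deriv \<nu> \<beta> k (h m) x)
        \<le> C * exp (- (norm x)\<^sup>2 / 4)" for m
      using C[of "h m"] h by (auto simp: less_imp_le)
  qed measurable
  \<comment> \<open>For every \<open>h m\<close> > 0 the integral is 0 by the divergence identity,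
    hence so is the limit.\<close>
  then have "(\<integral>x. reg_weight \<nu> \<beta> 0 x * symm_log_deriv \<nu> \<beta> k 0 x \<partial>(lborel :: (real, 'n) vec measure)) = 0"
    using integral_symm_log_deriv[OF assms h(1,2), where 'n = 'n] by (simp add: LIMSEQ_const_iff)
  also have "(\<integral>x. reg_weight \<nu> \<beta> 0 x * symm_log_deriv \<nu> \<beta> k 0 x \<partial>(lborel :: (real, 'n) vec measure))
      = (\<integral>x. rate TYPE('n) \<nu> \<beta> k * (reg_weight \<nu> \<beta> 0 x * esym UNIV k (sq x))
          - real (Suc k) * (reg_weight \<nu> \<beta> 0 x * esym UNIV (Suc k) (sq x)) \<partial>(lborel :: (real, 'n) vec measure))"
  proof (rule integral_cong_AE)
    show "AE x in (lborel :: (real, 'n) vec measure). reg_weight \<nu> \<beta> 0 x * symm_log_deriv \<nu> \<beta> k 0 x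
        = rate TYPE('n) \<nu> \<beta> k * (reg_weight \<nu> \<beta> 0 x * esym UNIV k (sq x))
          - real (Suc k) * (reg_weight \<nu> \<beta> 0 x * esym UNIV (Suc k) (sq x))"
      using AE_regular by eventually_elim (simp add: symm_log_deriv_0 algebra_simps)
  qed measurable
  also have "\<dots> = rate TYPE('n) \<nu> \<beta> k * (\<integral>x. reg_weight \<nu> \<beta> 0 x * esym UNIV k (sq x) \<partial>(lborel :: (real, 'n) vec measure))
      - real (Suc k) * (\<integral>x. reg_weight \<nu> \<beta> 0 x * esym UNIV (Suc k) (sq x) \<partial>(lborel :: (real, 'n) vec measure))"
    using integrable_weight_esym[OF assms, where 'n = 'n] by simp
  finally show ?thesis by simp
qed

text \<open>Iterating the recursion expresses each moment relative to the total mass, which later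
  cancels against \<open>c_B\<close>.\<close>

lemma weight_moments:
  assumes "\<nu> \<ge> 0" "\<beta> > 0"
  shows "(\<integral>x. reg_weight \<nu> \<beta> 0 x * esym UNIV k (sq x) \<partial>(lborel :: (real, 'n::{finite, linorder}) vec measure))
    = moment_coeff TYPE('n) \<nu> \<beta> k * (\<integral>x. reg_weight \<nu> \<beta> 0 x \<partial>(lborel :: (real, 'n) vec measure))"
proof (induction k)
  case 0
  then show ?case by (simp add: esym_0 moment_coeff_def)
next
  case (Suc k)
  then show ?case
    using weight_moment_recursion[OF assms, of k, where 'n = 'n] by (simp add: moment_coeff_def field_simps)
qed

section \<open>Scaling in time and the normalization constant\<close>

lemma unnormalized_density_scale:
  fixes z :: "real ^ 'n::{finite, linorder}"
  assumes t: "t > 0"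
  shows "unnormalized_density_B \<nu> \<beta> t (sqrt t *\<^sub>R z) = t powr (- real CARD('n) / 2) * unnormalized_density_B \<nu> \<beta> 1 z"
proof -
  define P where "P = {(i, j). i < (j :: 'n)}"
  have card_P: "2 * real (card P) = real CARD('n) * (real CARD('n) - 1)"
    using sum_pairs_less[of "\<lambda>i j :: 'n. 1"] by (simp add: P_def case_prod_beta' of_nat_diff Suc_leI)
  have pairs: "(\<Prod>(i, j)\<in>P. \<bar>((sqrt t *\<^sub>R z) $ i)\<^sup>2 - ((sqrt t *\<^sub>R z) $ j)\<^sup>2\<bar> powr (2 * \<beta>))
      = t powr (2 * \<beta> * card P) * (\<Prod>(i, j)\<in>P. \<bar>(z $ i)\<^sup>2 - (z $ j)\<^sup>2\<bar> powr (2 * \<beta>))"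
  proof -
    have "\<bar>((sqrt t *\<^sub>R z) $ i)\<^sup>2 - ((sqrt t *\<^sub>R z) $ j)\<^sup>2\<bar> = t * \<bar>(z $ i)\<^sup>2 - (z $ j)\<^sup>2\<bar>" for i j
      using t by (simp add: power_mult_distrib right_diff_distrib[symmetric] abs_mult)
    then have "(\<Prod>(i, j)\<in>P. \<bar>((sqrt t *\<^sub>R z) $ i)\<^sup>2 - ((sqrt t *\<^sub>R z) $ j)\<^sup>2\<bar> powr (2 * \<beta>))
        = (\<Prod>p\<in>P. t powr (2 * \<beta>) * (case p of (i, j) \<Rightarrow> \<bar>(z $ i)\<^sup>2 - (z $ j)\<^sup>2\<bar> powr (2 * \<beta>)))"
      using t by (intro prod.cong) (auto simp: powr_mult)
    also have "\<dots> = (t powr (2 * \<beta>)) ^ card P * (\<Prod>(i, j)\<in>P. \<bar>(z $ i)\<^sup>2 - (z $ j)\<^sup>2\<bar> powr (2 * \<beta>))"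
      by (simp add: prod.distrib)
    also have "(t powr (2 * \<beta>)) ^ card P = t powr (2 * \<beta> * card P)"
      using t by (simp add: powr_powr[symmetric] powr_realpow)
    finally show ?thesis .
  qed
  have singles: "(\<Prod>i\<in>UNIV. \<bar>(sqrt t *\<^sub>R z) $ i\<bar> powr (2 * \<beta> * \<nu>))
      = t powr (\<beta> * \<nu> * real CARD('n)) * (\<Prod>i\<in>UNIV. \<bar>z $ i\<bar> powr (2 * \<beta> * \<nu>))"
  proof -
    have "\<bar>(sqrt t *\<^sub>R z) $ i\<bar> powr (2 * \<beta> * \<nu>) = t powr (\<beta> * \<nu>) * \<bar>z $ i\<bar> powr (2 * \<beta> * \<nu>)" for i
      using t by (simp add: abs_mult powr_mult powr_half_sqrt[symmetric] powr_powr)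
    then have "(\<Prod>i\<in>UNIV. \<bar>(sqrt t *\<^sub>R z) $ i\<bar> powr (2 * \<beta> * \<nu>))
        = (t powr (\<beta> * \<nu>)) ^ CARD('n) * (\<Prod>i\<in>UNIV. \<bar>z $ i\<bar> powr (2 * \<beta> * \<nu>))"
      by (simp add: prod.distrib)
    also have "(t powr (\<beta> * \<nu>)) ^ CARD('n) = t powr (\<beta> * \<nu> * real CARD('n))"
      using t by (simp add: powr_powr[symmetric] powr_realpow)
    finally show ?thesis .
  qed
  have "2 * \<beta> * real (card P) = \<beta> * real CARD('n) * (real CARD('n) - 1)"
    using card_P by (metis mult.assoc mult.left_commute)
  \<comment> \<open>The pair product scales with exponent \<beta> N (N - 1) in t and the coordinate
    product with \<beta> \<nu> N. Their sum is \<open>gamma_B\<close>, so only -N/2 is left, to be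
    offset by the Jacobian.\<close>
  then have exponent: "- gamma_B TYPE('n) \<nu> \<beta> - real CARD('n) / 2 + 2 * \<beta> * card P + \<beta> * \<nu> * real CARD('n) = - real CARD('n) / 2"
    by (simp add: gamma_B_def)
  then have pow: "t powr (- gamma_B TYPE('n) \<nu> \<beta> - real CARD('n) / 2) * t powr (2 * \<beta> * card P) * t powr (\<beta> * \<nu> * real CARD('n))
      = t powr (- real CARD('n) / 2)"
    by (simp only: powr_add[symmetric] exponent)
  have gauss: "exp (- (norm (sqrt t *\<^sub>R z))\<^sup>2 / (2 * t)) = exp (- (norm z)\<^sup>2 / (2 * 1))"
    using t by (simp add: power_mult_distrib)
  show ?thesis
    unfolding unnormalized_density_B_def P_def[symmetric] pairs singles gauss pow[symmetric]
    by (simp add: mult_ac)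
qed

lemma measurable_unnormalized_density [measurable]:
  "unnormalized_density_B \<nu> \<beta> t \<in> borel_measurable (borel :: (real, 'n::{finite, linorder}) vec measure)"
  unfolding unnormalized_density_B_def case_prod_beta' by measurable

definition weight_mass :: "'n::{finite, linorder} itself \<Rightarrow> real \<Rightarrow> real \<Rightarrow> real" where
  "weight_mass _ \<nu> \<beta> = (\<integral>x. unnormalized_density_B \<nu> \<beta> 1 x \<partial>(lborel :: (real, 'n) vec measure))"

text \<open>Substituting x = sqrt t z, homogeneity of e_k in the squares gives t^k, and the Jacobian
  t^(N/2) cancels the remaining power of t. The case k = 0 shows that the mass is the same for all
  t.\<close>

lemma density_moments:
  assumes "\<nu> \<ge> 0" "\<beta> > 0" and t: "t > 0"
  shows "integrable lborel (\<lambda>x :: (real, 'n::{finite, linorder}) vec. esym UNIV k (sq x) * unnormalized_density_B \<nu> \<beta> t x)"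
    and "(\<integral>x. esym UNIV k (sq x) * unnormalized_density_B \<nu> \<beta> t x \<partial>(lborel :: (real, 'n) vec measure))
      = moment_coeff TYPE('n) \<nu> \<beta> k * t ^ k * weight_mass TYPE('n) \<nu> \<beta>"
proof -
  define c where "c = t ^ k * t powr (- real CARD('n) / 2)"
  have esym_scale: "esym UNIV k (sq (sqrt t *\<^sub>R z)) = t ^ k * esym UNIV k (sq z)" for z :: "(real, 'n) vec"
  proof -
    have "(\<Prod>i\<in>S. t * (z $ i)\<^sup>2) = t ^ card S * (\<Prod>i\<in>S. (z $ i)\<^sup>2)" for S by (simp add: prod.distrib)
    then show ?thesis using t by (simp add: esym_def power_mult_distrib sum_distrib_left)
  qed
  have scaled: "esym UNIV k (sq (sqrt t *\<^sub>R z)) * unnormalized_density_B \<nu> \<beta> t (sqrt t *\<^sub>R z)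
      = c * (reg_weight \<nu> \<beta> 0 z * esym UNIV k (sq z))" for z :: "(real, 'n) vec"
    unfolding esym_scale unnormalized_density_scale[OF t] reg_weight_0_eq c_def by (simp add: mult_ac)
  have int: "integrable lborel (\<lambda>z :: (real, 'n) vec. esym UNIV k (sq (sqrt t *\<^sub>R z)) * unnormalized_density_B \<nu> \<beta> t (sqrt t *\<^sub>R z))"
    unfolding scaled by (intro integrable_mult_right integrable_weight_esym assms)
  have meas: "(\<lambda>x :: (real, 'n) vec. esym UNIV k (sq x) * unnormalized_density_B \<nu> \<beta> t x) \<in> borel_measurable borel"
    by measurable
  note scale = integral_scale[OF _ meas int]
  show "integrable lborel (\<lambda>x :: (real, 'n) vec. esym UNIV k (sq x) * unnormalized_density_B \<nu> \<beta> t x)"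
    using scale(1) t by simp
  have W: "(\<integral>x. reg_weight \<nu> \<beta> 0 x * esym UNIV k (sq x) \<partial>(lborel :: (real, 'n) vec measure))
      = moment_coeff TYPE('n) \<nu> \<beta> k * weight_mass TYPE('n) \<nu> \<beta>"
    using weight_moments[OF assms(1,2), of k, where 'n = 'n] by (simp add: weight_mass_def reg_weight_0_eq)
  have "sqrt t ^ CARD('n) * c = t ^ k"
  proof -
    have "sqrt t ^ CARD('n) = t powr (real CARD('n) / 2)"
      using t by (simp add: powr_half_sqrt[symmetric] powr_realpow[symmetric] powr_powr)
    then show ?thesis using t by (simp add: c_def powr_add[symmetric] mult.left_commute)
  qed
  then show "(\<integral>x. esym UNIV k (sq x) * unnormalized_density_B \<nu> \<beta> t x \<partial>(lborel :: (real, 'n) vec measure))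
      = moment_coeff TYPE('n) \<nu> \<beta> k * t ^ k * weight_mass TYPE('n) \<nu> \<beta>"
    using scale(2) t unfolding scaled by (simp add: W mult_ac)
qed

text \<open>A nonnegative function with integral 0 vanishes almost everywhere, whereas the weight is
  nonzero off the hyperplanes of \<open>AE_regular\<close>.\<close>

lemma weight_mass_pos:
  assumes "\<nu> \<ge> 0" "\<beta> > 0"
  shows "weight_mass TYPE('n::{finite, linorder}) \<nu> \<beta> > 0"
proof -
  let ?w = "reg_weight \<nu> \<beta> 0 :: (real, 'n) vec \<Rightarrow> real"
  have eq: "weight_mass TYPE('n) \<nu> \<beta> = integral\<^sup>L lborel ?w"
    unfolding weight_mass_def by (intro Bochner_Integration.integral_cong refl) (simp add: reg_weight_0_eq)
  have int: "integrable lborel ?w"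
    using integrable_weight_esym[OF assms, of 0, where 'n = 'n] by (simp add: esym_0)
  have "\<not> (AE x in lborel. ?w x = 0)"
  proof
    assume "AE x in lborel. ?w x = 0"
    with AE_regular have "AE x in (lborel :: (real, 'n) vec measure). False"
    proof eventually_elim
      case (elim x)
      then show False
        using assms by (auto simp: reg_weight_def poly_weight_def prod_zero_iff)
    qed
    then have "emeasure (lborel :: (real, 'n) vec measure) UNIV = 0"
      by (simp add: AE_iff_measurable[OF _ refl])
    then show False by simp
  qed
  then have "integral\<^sup>L lborel ?w \<noteq> 0"
    using integral_nonneg_eq_0_iff_AE[OF int] by (simp add: reg_weight_nonneg)
  moreover have "integral\<^sup>L lborel ?w \<ge> 0" by (simp add: reg_weight_nonneg)
  ultimately show ?thesis by (simp add: eq)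
qed

text \<open>At each t the probability condition reads c Z = 1 with the same mass Z. Hence the
  condition at t = 1 already determines c, and the solution works for all t, which is what
  \<open>THE\<close> requires.\<close>

lemma c_B_eq:
  assumes "\<nu> \<ge> 0" "\<beta> > 0"
  shows "c_B TYPE('n::{finite, linorder}) \<nu> \<beta> = 1 / weight_mass TYPE('n) \<nu> \<beta>"
proof -
  let ?Z = "weight_mass TYPE('n) \<nu> \<beta>"
  have prob_iff: "prob_space (density lborel (\<lambda>x :: (real, 'n) vec. ennreal (c * unnormalized_density_B \<nu> \<beta> t x))) \<longleftrightarrow> c * ?Z = 1"
    if c: "c > 0" and t: "t > 0" for c t
  proof -
    let ?d = "density lborel (\<lambda>x :: (real, 'n) vec. ennreal (c * unnormalized_density_B \<nu> \<beta> t x))"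
    have nonneg: "0 \<le> unnormalized_density_B \<nu> \<beta> t x" for x :: "(real, 'n) vec"
      unfolding unnormalized_density_B_def by (intro mult_nonneg_nonneg prod_nonneg) auto
    have "integrable lborel (unnormalized_density_B \<nu> \<beta> t :: (real, 'n) vec \<Rightarrow> real)"
      "integral\<^sup>L lborel (unnormalized_density_B \<nu> \<beta> t :: (real, 'n) vec \<Rightarrow> real) = ?Z"
      using density_moments[OF assms t, of 0, where 'n = 'n] by (simp_all add: esym_0 moment_coeff_def)
    then have "(\<integral>\<^sup>+x. ennreal (c * unnormalized_density_B \<nu> \<beta> t x) \<partial>(lborel :: (real, 'n) vec measure)) = ennreal (c * ?Z)"
      using c nonneg by (subst nn_integral_eq_integral) auto
    then have "emeasure ?d (space ?d) = ennreal (c * ?Z)"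
      by (simp add: emeasure_density)
    then show ?thesis
      using prob_space.emeasure_space_1[of ?d] prob_spaceI[of ?d] by (auto simp: ennreal_eq_1)
  qed
  show ?thesis
    unfolding c_B_def
  proof (rule the_equality)
    show "1 / ?Z > 0 \<and> (\<forall>t>0. prob_space (density lborel (\<lambda>x :: (real, 'n) vec. ennreal (1 / ?Z * unnormalized_density_B \<nu> \<beta> t x))))"
      using prob_iff[of "1 / ?Z"] weight_mass_pos[OF assms, where 'n = 'n] by auto
    fix c assume "c > 0 \<and> (\<forall>t>0. prob_space (density lborel (\<lambda>x :: (real, 'n) vec. ennreal (c * unnormalized_density_B \<nu> \<beta> t x))))"
    then have "c * ?Z = 1" using prob_iff[of c 1] by simp
    then show "c = 1 / ?Z" using weight_mass_pos[OF assms, where 'n = 'n] by (simp add: field_simps)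
  qed
qed

section \<open>Closed form of the moments and the Laguerre polynomial\<close>

lemma moment_coeff_eq:
  assumes "\<beta> > 0" "k \<le> CARD('n::finite)"
  shows "moment_coeff TYPE('n) \<nu> \<beta> k
    = ((real CARD('n) + \<nu> + 1 / (2 * \<beta>) - 1) gchoose k) * (fact CARD('n) / fact (CARD('n) - k)) * (2 * \<beta>) ^ k"
  using assms(2)
proof (induction k)
  case 0
  then show ?case by (simp add: moment_coeff_def)
next
  case (Suc k)
  let ?a = "real CARD('n) + \<nu> + 1 / (2 * \<beta>) - 1"
  define r where "r = real (CARD('n) - k)"
  have r: "r > 0" "r = real CARD('n) - real k" using Suc.prems by (auto simp: r_def of_nat_diff)
  have f: "fact (CARD('n) - k) = r * fact (CARD('n) - Suc k)"
    using Suc.prems fact_reduce[of "CARD('n) - k", where 'a = real] by (simp add: r_def)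
  \<comment> \<open>The second factor of \<open>rate\<close> is 2 \<beta> (a - k) with a = N + \<nu>
    + 1/(2 \<beta>) - 1. This is where the upper entry of the binomial comes from: the factors a - j
    over j! build the binomial, the factors N - j the quotient of factorials.\<close>
  have rate: "rate TYPE('n) \<nu> \<beta> k = r * (2 * \<beta>) * (?a - real k)"
    using assms(1) by (simp add: rate_def r(2) field_simps)
  have "moment_coeff TYPE('n) \<nu> \<beta> (Suc k) = moment_coeff TYPE('n) \<nu> \<beta> k * (rate TYPE('n) \<nu> \<beta> k / real (Suc k))"
    by (simp add: moment_coeff_def)
  also have "\<dots> = ((?a gchoose k) * (?a - real k) / real (Suc k)) * (fact CARD('n) / fact (CARD('n) - Suc k)) * (2 * \<beta>) ^ Suc k"
    unfolding rate Suc.IH[OF Suc_leD[OF Suc.prems]] f using r(1) by (simp add: mult_ac)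
  also have "(?a gchoose k) * (?a - real k) / real (Suc k) = ?a gchoose Suc k"
    by (simp add: gbinomial_prod_rev)
  finally show ?case .
qed

lemma laguerre_expansion:
  assumes \<beta>: "\<beta> > 0" and t: "t > 0"
  shows "(\<Sum>k\<le>CARD('n::finite). (- 1) ^ k * (moment_coeff TYPE('n) \<nu> \<beta> k * t ^ k) * y ^ (CARD('n) - k))
    = (2 * t * \<beta>) ^ CARD('n) * (- 1) ^ CARD('n) * fact CARD('n)
             * laguerre CARD('n) (\<nu> + 1 / (2 * \<beta>) - 1) (y / (2 * t * \<beta>))"
proof -
  let ?N = "CARD('n)" and ?a = "real CARD('n) + \<nu> + 1 / (2 * \<beta>) - 1" and ?c = "2 * t * \<beta>"
  have c: "?c \<noteq> 0" using assms by simp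
  have "?c ^ ?N * (- 1) ^ ?N * fact ?N * laguerre ?N (\<nu> + 1 / (2 * \<beta>) - 1) (y / ?c)
      = (\<Sum>j\<le>?N. ?c ^ ?N * (- 1) ^ ?N * fact ?N * ((?a gchoose (?N - j)) * (- (y / ?c)) ^ j / fact j))"
    by (simp add: laguerre_def sum_distrib_left algebra_simps)
  \<comment> \<open>The Laguerre sum runs over the power of y, the moment sum over the degree of
    e_k; the indices are complementary, j = N - k.\<close>
  also have "\<dots> = (\<Sum>k\<le>?N. ?c ^ ?N * (- 1) ^ ?N * fact ?N * ((?a gchoose k) * (- (y / ?c)) ^ (?N - k) / fact (?N - k)))"
    by (rule sum.reindex_bij_witness[of _ "\<lambda>k. ?N - k" "\<lambda>k. ?N - k"]) auto
  also have "\<dots> = (\<Sum>k\<le>?N. (- 1) ^ k * (moment_coeff TYPE('n) \<nu> \<beta> k * t ^ k) * y ^ (?N - k))"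
  proof (intro sum.cong refl)
    fix k assume "k \<in> {..?N}"
    then have k: "k \<le> ?N" by simp
    have pow: "?c ^ ?N = ?c ^ k * ?c ^ (?N - k)" "(- 1 :: real) ^ ?N = (- 1) ^ k * (- 1) ^ (?N - k)"
      using k by (simp_all add: power_add[symmetric])
    have quot: "(- (y / ?c)) ^ (?N - k) = (- 1) ^ (?N - k) * (y ^ (?N - k) / ?c ^ (?N - k))"
      by (metis mult_minus1 power_mult_distrib power_divide)
    \<comment> \<open>One copy of this power comes from splitting (-1)^N, the other from the
      negative argument in the Laguerre sum; what remains is (-1)^k.\<close>
    have sign: "(- 1 :: real) ^ (?N - k) * (- 1) ^ (?N - k) = 1"
      by (simp add: power_mult_distrib[symmetric])
    have "?c ^ ?N * (- 1) ^ ?N * fact ?N * ((?a gchoose k) * (- (y / ?c)) ^ (?N - k) / fact (?N - k))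
        = (- 1) ^ k * ((?a gchoose k) * (fact ?N / fact (?N - k)) * ?c ^ k) * y ^ (?N - k)
          * ((- 1) ^ (?N - k) * (- 1) ^ (?N - k)) * (?c ^ (?N - k) / ?c ^ (?N - k))"
      unfolding pow quot by (simp only: times_divide_eq_right times_divide_eq_left divide_divide_eq_left mult_ac)
    also have "\<dots> = (- 1) ^ k * ((?a gchoose k) * (fact ?N / fact (?N - k)) * ?c ^ k) * y ^ (?N - k)"
      using c sign by simp
    also have "?c ^ k = (2 * \<beta>) ^ k * t ^ k" by (simp add: power_mult_distrib)
    finally show "?c ^ ?N * (- 1) ^ ?N * fact ?N * ((?a gchoose k) * (- (y / ?c)) ^ (?N - k) / fact (?N - k))
        = (- 1) ^ k * (moment_coeff TYPE('n) \<nu> \<beta> k * t ^ k) * y ^ (?N - k)"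
      by (simp add: moment_coeff_eq[OF \<beta> k] mult.assoc)
  qed
  finally show ?thesis ..
qed

theorem corollary3p7:
  fixes M :: "'a measure" and X :: "real \<Rightarrow> 'a \<Rightarrow> real ^ 'n::{finite, linorder}"
    and \<nu> \<beta> :: real
  assumes "\<nu> \<ge> 0" and "\<beta> > 0" and "bessel_process_B M \<nu> \<beta> 0 X"
  shows
    "(\<forall>t>0. \<forall>y :: real.
       integrable M (\<lambda>\<omega>. \<Prod>i\<in>UNIV. (y - (X t \<omega> $ i)\<^sup>2)) \<and>
       integrable lborel (\<lambda>x :: (real, 'n) vec.
         (\<Prod>i\<in>UNIV. (y - (x $ i)\<^sup>2)) * unnormalized_density_B \<nu> \<beta> t x) \<and>
       (\<integral>\<omega>. (\<Prod>i\<in>UNIV. (y - (X t \<omega> $ i)\<^sup>2)) \<partial>M)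
         = c_B TYPE('n) \<nu> \<beta> * (\<integral>x.
             (\<Prod>i\<in>UNIV. (y - (x $ i)\<^sup>2)) * unnormalized_density_B \<nu> \<beta> t x \<partial>(lborel :: (real, 'n) vec measure)) \<and>
       c_B TYPE('n) \<nu> \<beta> * (\<integral>x.
             (\<Prod>i\<in>UNIV. (y - (x $ i)\<^sup>2)) * unnormalized_density_B \<nu> \<beta> t x \<partial>(lborel :: (real, 'n) vec measure))
         = (2 * t * \<beta>) ^ CARD('n) * (- 1) ^ CARD('n) * fact CARD('n)
             * laguerre CARD('n) (\<nu> + 1 / (2 * \<beta>) - 1) (y / (2 * t * \<beta>)))
     \<and>
     (\<forall>t>0. \<forall>k\<le>CARD('n).
       integrable M (\<lambda>\<omega>. elem_sym k (\<chi> i. (X t \<omega> $ i)\<^sup>2)) \<and>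
       (\<integral>\<omega>. elem_sym k (\<chi> i. (X t \<omega> $ i)\<^sup>2) \<partial>M)
         = ((real CARD('n) + \<nu> + 1 / (2 * \<beta>) - 1) gchoose k)
             * (fact CARD('n) / fact (CARD('n) - k)) * (2 * t * \<beta>) ^ k)"
proof (intro conjI allI impI)
  fix t :: real assume t: "t > 0"
  note mom = bessel_process_moments[OF assms less_imp_le[OF t]]
  note dens = density_moments[OF assms(1,2) t, where 'n = 'n]
  let ?N = "CARD('n)" and ?Z = "weight_mass TYPE('n) \<nu> \<beta>"
  \<comment> \<open>By Vieta the expectation becomes \<open>?L y\<close> and the density integral
    \<open>?L y * ?Z\<close>; the constant \<open>c_B\<close> = 1 / \<open>?Z\<close> makes them
    equal.\<close>
  let ?L = "\<lambda>y. \<Sum>k\<le>?N. (- 1) ^ k * (moment_coeff TYPE('n) \<nu> \<beta> k * t ^ k) * y ^ (?N - k)"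
  fix y :: real
  have expand: "(\<Prod>i\<in>UNIV. (y - (x $ i)\<^sup>2)) = (\<Sum>k\<le>?N. (- 1) ^ k * y ^ (?N - k) * esym UNIV k (sq x))" for x :: "(real, 'n) vec"
    using prod_diff_esym[of "UNIV :: 'n set" y "sq x"] by (simp add: mult_ac)
  have expand_dens: "(\<Prod>i\<in>UNIV. (y - (x $ i)\<^sup>2)) * unnormalized_density_B \<nu> \<beta> t x
      = (\<Sum>k\<le>?N. (- 1) ^ k * y ^ (?N - k) * (esym UNIV k (sq x) * unnormalized_density_B \<nu> \<beta> t x))" for x :: "(real, 'n) vec"
    by (simp add: expand sum_distrib_right mult.assoc)
  show "integrable M (\<lambda>\<omega>. \<Prod>i\<in>UNIV. (y - (X t \<omega> $ i)\<^sup>2))"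
    unfolding expand by (intro Bochner_Integration.integrable_sum integrable_mult_right mom)
  show "integrable lborel (\<lambda>x :: (real, 'n) vec. (\<Prod>i\<in>UNIV. (y - (x $ i)\<^sup>2)) * unnormalized_density_B \<nu> \<beta> t x)"
    unfolding expand_dens by (intro Bochner_Integration.integrable_sum integrable_mult_right dens)
  have EX: "(\<integral>\<omega>. (\<Prod>i\<in>UNIV. (y - (X t \<omega> $ i)\<^sup>2)) \<partial>M) = ?L y"
    unfolding expand
    by (subst Bochner_Integration.integral_sum) (auto simp: mom intro!: sum.cong)
  have Ed: "(\<integral>x. (\<Prod>i\<in>UNIV. (y - (x $ i)\<^sup>2)) * unnormalized_density_B \<nu> \<beta> t x \<partial>(lborel :: (real, 'n) vec measure)) = ?L y * ?Z"
    unfolding expand_dens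
    by (subst Bochner_Integration.integral_sum)
      (auto simp: dens sum_distrib_right intro!: sum.cong integrable_mult_right)
  have Z: "c_B TYPE('n) \<nu> \<beta> * (?L y * ?Z) = ?L y"
    using weight_mass_pos[OF assms(1,2), where 'n = 'n] by (simp add: c_B_eq[OF assms(1,2)])
  show "(\<integral>\<omega>. (\<Prod>i\<in>UNIV. (y - (X t \<omega> $ i)\<^sup>2)) \<partial>M)
         = c_B TYPE('n) \<nu> \<beta> * (\<integral>x.
             (\<Prod>i\<in>UNIV. (y - (x $ i)\<^sup>2)) * unnormalized_density_B \<nu> \<beta> t x \<partial>(lborel :: (real, 'n) vec measure))"
    unfolding Ed Z EX ..
  show "c_B TYPE('n) \<nu> \<beta> * (\<integral>x.
             (\<Prod>i\<in>UNIV. (y - (x $ i)\<^sup>2)) * unnormalized_density_B \<nu> \<beta> t x \<partial>(lborel :: (real, 'n) vec measure))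
         = (2 * t * \<beta>) ^ CARD('n) * (- 1) ^ CARD('n) * fact CARD('n)
             * laguerre CARD('n) (\<nu> + 1 / (2 * \<beta>) - 1) (y / (2 * t * \<beta>))"
    unfolding Ed Z by (rule laguerre_expansion[OF assms(2) t])
next
  fix t :: real and k assume t: "t > 0" and k: "k \<le> CARD('n)"
  note mom = bessel_process_moments[OF assms less_imp_le[OF t]]
  show "integrable M (\<lambda>\<omega>. elem_sym k (\<chi> i. (X t \<omega> $ i)\<^sup>2))"
    using mom(1)[of k] by (simp add: elem_sym_eq_esym)
  show "(\<integral>\<omega>. elem_sym k (\<chi> i. (X t \<omega> $ i)\<^sup>2) \<partial>M)
         = ((real CARD('n) + \<nu> + 1 / (2 * \<beta>) - 1) gchoose k)
             * (fact CARD('n) / fact (CARD('n) - k)) * (2 * t * \<beta>) ^ k"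
    using mom(2)[of k] by (simp add: elem_sym_eq_esym moment_coeff_eq[OF assms(2) k] power_mult_distrib)
qed

end
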